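(* Let $G=(V,E)$ with $V=\{1,\dots,n\}$ be a bidirectional and connected directed graph, let $\{\mathbf{r}_{ij}\}_{(i,j)\in E}\subset\mathbb{R}^d$ be such that there exists at least one collection of points in formation, and let $\{f_{ij}\}_{(i,j)\in E}$ be positive numbers satisfying $\sum_{j\in N(i)}f_{ij}<1$ for all $i$ and $f_{ij}=f_{ji}$ for all $(i,j)\in E$. Consider the noisy formation control update $$\mathbf{p}_i(t+1)=\mathbf{p}_i(t)+\sum_{j\in N(i)}f_{ij}\left(\mathbf{p}_j(t)-\mathbf{p}_i(t)-\mathbf{r}_{ij}\right)+\mathbf{n}_i(t),\qquad i=1,\dots,n,$$ and assume that $E[\mathbf{n}_i(t)\mathbf{n}_i(t)^T]=\lambda^2I$ for all $i=1,\dots,n$ and all $t$. Then $$\mathrm{Form}(G,\{f_{ij}\})=d\cdot\lambda^2\,\frac{K\left((P^{\rm form})^2\right)}{n}.$$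
   Context: Graph: $G$ is a directed graph without self-loops; bidirectional means $(i,j)\in E$ implies $(j,i)\in E$; $N(i)=\{j:(i,j)\in E\}$. Formation: points $\mathbf{q}_1,\dots,\mathbf{q}_n\in\mathbb{R}^d$ are "in formation" if $\mathbf{q}_j-\mathbf{q}_i=\mathbf{r}_{ij}$ for all $(i,j)\in E$. Noise and initial condition: the initial positions $\mathbf{p}_i(0)\in\mathbb{R}^d$ are arbitrary and deterministic; the $\mathbf{n}_i(t)$ are random vectors in $\mathbb{R}^d$ with $E[\mathbf{n}_i(t)]=0$, and $\mathbf{n}_i(t_1)$ and $\mathbf{n}_j(t_2)$ are independent whenever $t_1\ne t_2$ or $i\neq j$. Performance measure: for each $t$, $\widehat{\mathbf{p}}_1(t),\dots,\widehat{\mathbf{p}}_n(t)$ is the collection of points in formation with the same centroid as $\mathbf{p}_1(t),\dots,\mathbf{p}_n(t)$, i.e. $\frac1n\sum_i\widehat{\mathbf{p}}_i(t)=\frac1n\sum_i\mathbf{p}_i(t)$. Then $$\mathrm{Form}(G,\{f_{ij}\})=\limsup_{t\to\infty}\frac1n\sum_{i=1}^nE\left[\|\mathbf{p}_i(t)-\widehat{\mathbf{p}}_i(t)\|_2^2\right].$$ Matrix: $P^{\rm form}$ is the $n\times n$ stochastic matrix with $P^{\rm form}_{ij}=f_{ij}$ for $(i,j)\in E$, $P^{\rm form}_{ij}=0$ for $i\ne j$ with $(i,j)\notin E$, and $P^{\rm form}_{ii}=1-\sum_{j\in N(i)}f_{ij}$. Kemeny constant: for an irreducible stochastic matrix $M$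 with stationary distribution $\pi$, $K(M)=\sum_{j=1}^n\pi_jH_M(i\to j)$, which is independent of $i$ (a classical fact); here $H_M(i\to j)$ is the expected time until the Markov chain with transition matrix $M$ started at $i$ first visits $j$, with $H_M(i\to i)=0$. *)

theory Defs
  imports
    "HOL-Probability.Probability"
    "Graph_Theory.Pair_Digraph"
    "Graph_Theory.Digraph_Component"
begin

subsection \<open>Formation control on a directed graph\<close>

definition neighbours :: "'n pair_pre_digraph \<Rightarrow> 'n \<Rightarrow> 'n set" where
  "neighbours G i = {j. (i, j) \<in> parcs G}"

definition in_formation ::
    "'n pair_pre_digraph \<Rightarrow> ('n \<Rightarrow> 'n \<Rightarrow> real ^ 'd) \<Rightarrow> ('n \<Rightarrow> real ^ 'd) \<Rightarrow> bool" where
  "in_formation G r q \<longleftrightarrow> (\<forall>(i, j) \<in> parcs G. q j - q i = r i j)"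

definition centroid :: "('n::finite \<Rightarrow> real ^ 'd) \<Rightarrow> real ^ 'd" where
  "centroid q = (1 / real CARD('n)) *\<^sub>R (\<Sum>i\<in>UNIV. q i)"

definition formation_of ::
    "'n::finite pair_pre_digraph \<Rightarrow> ('n \<Rightarrow> 'n \<Rightarrow> real ^ 'd) \<Rightarrow> ('n \<Rightarrow> real ^ 'd) \<Rightarrow> 'n \<Rightarrow> real ^ 'd" where
  "formation_of G r p = (THE q. in_formation G r q \<and> centroid q = centroid p)"

primrec position ::
    "'n pair_pre_digraph \<Rightarrow> ('n \<Rightarrow> 'n \<Rightarrow> real) \<Rightarrow> ('n \<Rightarrow> 'n \<Rightarrow> real ^ 'd) \<Rightarrow> ('n \<Rightarrow> real ^ 'd)
      \<Rightarrow> ('n \<Rightarrow> nat \<Rightarrow> 'w \<Rightarrow> real ^ 'd) \<Rightarrow> nat \<Rightarrow> 'w \<Rightarrow> 'n \<Rightarrow> real ^ 'd" where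
  "position G f r p0 noise 0 = (\<lambda>\<omega> i. p0 i)"
| "position G f r p0 noise (Suc t) = (\<lambda>\<omega> i.
     let p = position G f r p0 noise t \<omega>
     in p i + (\<Sum>j\<in>neighbours G i. f i j *\<^sub>R (p j - p i - r i j)) + noise i t \<omega>)"

text \<open>The expected squared distances are Lebesgue integrals of nonnegative functions, so the
  performance measure takes values in \<^typ>\<open>ennreal\<close> and needs no integrability side conditions.\<close>

definition Form ::
    "'n::finite pair_pre_digraph \<Rightarrow> ('n \<Rightarrow> 'n \<Rightarrow> real) \<Rightarrow> ('n \<Rightarrow> 'n \<Rightarrow> real ^ 'd) \<Rightarrow> ('n \<Rightarrow> real ^ 'd)
      \<Rightarrow> 'w measure \<Rightarrow> ('n \<Rightarrow> nat \<Rightarrow> 'w \<Rightarrow> real ^ 'd) \<Rightarrow> ennreal" where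
  "Form G f r p0 M noise = limsup (\<lambda>t.
     (\<Sum>i\<in>UNIV. \<integral>\<^sup>+\<omega>. (let p = position G f r p0 noise t \<omega>
        in ennreal ((norm (p i - formation_of G r p i))\<^sup>2)) \<partial>M) / of_nat CARD('n))"

definition P_form :: "'n::finite pair_pre_digraph \<Rightarrow> ('n \<Rightarrow> 'n \<Rightarrow> real) \<Rightarrow> real ^ 'n ^ 'n" where
  "P_form G f = (\<chi> i j. if i = j then 1 - (\<Sum>k\<in>neighbours G i. f i k)
     else if (i, j) \<in> parcs G then f i j else 0)"

definition outer :: "real ^ 'd \<Rightarrow> real ^ 'd \<Rightarrow> real ^ 'd ^ 'd" where
  "outer x y = (\<chi> a b. x $ a * y $ b)"


subsection \<open>Markov chains and the Kemeny constant\<close>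

definition stochastic :: "real ^ 'n ^ 'n \<Rightarrow> bool" where
  "stochastic A \<longleftrightarrow> (\<forall>i j. 0 \<le> A $ i $ j) \<and> (\<forall>i. (\<Sum>j\<in>UNIV. A $ i $ j) = 1)"

definition chain_kernel :: "real ^ 'n ^ 'n::finite \<Rightarrow> 'n \<Rightarrow> nat \<Rightarrow> (nat \<Rightarrow> 'n) \<Rightarrow> 'n measure" where
  "chain_kernel A i t \<omega> = (case t of
     0 \<Rightarrow> return (count_space UNIV) i
   | Suc s \<Rightarrow> point_measure UNIV (\<lambda>j. ennreal (A $ \<omega> s $ j)))"

text \<open>The law on path space of the Markov chain with transition matrix \<open>A\<close> started at \<open>i\<close>,
  obtained from the Ionescu-Tulcea extension theorem. The lemma \<open>emeasure_markov_chain\<close> below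
  gives its finite-dimensional distributions.\<close>

definition markov_chain :: "real ^ 'n ^ 'n::finite \<Rightarrow> 'n \<Rightarrow> (nat \<Rightarrow> 'n) measure" where
  "markov_chain A i = projective_family.lim UNIV
     (Ionescu_Tulcea.CI (chain_kernel A i) (\<lambda>_. count_space UNIV)) (\<lambda>_. count_space UNIV)"

lemma Ionescu_Tulcea_chain_kernel:
  fixes A :: "real ^ 'n ^ 'n::finite"
  assumes "stochastic A"
  shows "Ionescu_Tulcea (chain_kernel A i) (\<lambda>_. count_space UNIV)"
proof (rule Ionescu_Tulcea.intro)
  fix t :: nat
  have p: "prob_space (point_measure UNIV (\<lambda>j. ennreal (A $ k $ j)))" for k
    using assms by (intro prob_spaceI)
      (simp add: emeasure_point_measure_finite space_point_measure sum_ennreal stochastic_def)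
  have ks: "chain_kernel A i t \<omega> \<in> space (subprob_algebra (count_space UNIV))"
    and kp: "prob_space (chain_kernel A i t \<omega>)" for \<omega>
    using p by (auto simp: chain_kernel_def space_subprob_algebra sets_point_measure
        intro!: prob_space_return prob_space_imp_subprob_space split: nat.split)
  show "prob_space (chain_kernel A i t \<omega>)" for \<omega> by (rule kp)
  show "chain_kernel A i t \<in> Pi\<^sub>M {0..<t} (\<lambda>_. count_space UNIV) \<rightarrow>\<^sub>M subprob_algebra (count_space UNIV)"
  proof (cases t)
    case 0
    have "chain_kernel A i 0 = (\<lambda>_. return (count_space UNIV) i)"
      by (auto simp: chain_kernel_def)
    then show ?thesis using 0 ks[of undefined] by auto
  next
    case (Suc s)
    have "(\<lambda>k. point_measure UNIV (\<lambda>j. ennreal (A $ k $ j)))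
        \<in> count_space UNIV \<rightarrow>\<^sub>M subprob_algebra (count_space UNIV)"
      using p by (auto simp: space_subprob_algebra sets_point_measure
          intro!: prob_space_imp_subprob_space)
    moreover have "(\<lambda>\<omega>. \<omega> s) \<in> Pi\<^sub>M {0..<t} (\<lambda>_. count_space UNIV) \<rightarrow>\<^sub>M count_space (UNIV::'n set)"
      using Suc by (intro measurable_component_singleton) auto
    ultimately have "(\<lambda>\<omega>. point_measure UNIV (\<lambda>j. ennreal (A $ \<omega> s $ j)))
        \<in> Pi\<^sub>M {0..<t} (\<lambda>_. count_space UNIV) \<rightarrow>\<^sub>M subprob_algebra (count_space UNIV)"
      by (rule measurable_compose[rotated])
    moreover have "chain_kernel A i t = (\<lambda>\<omega>. point_measure UNIV (\<lambda>j. ennreal (A $ \<omega> s $ j)))"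
      using Suc by (auto simp: chain_kernel_def)
    ultimately show ?thesis by simp
  qed
qed

lemma emeasure_markov_chain:
  fixes A :: "real ^ 'n ^ 'n::finite"
  assumes "stochastic A"
  shows "emeasure (markov_chain A i) {\<omega>. \<forall>s\<le>t. \<omega> s = x s} =
    (if x 0 = i then \<Prod>s<t. ennreal (A $ x s $ x (Suc s)) else 0)"
proof -
  let ?N = "\<lambda>_::nat. count_space (UNIV::'n set)"
  interpret IT: Ionescu_Tulcea "chain_kernel A i" ?N
    by (rule Ionescu_Tulcea_chain_kernel[OF assms])
  define X where "X n = {restrict x {0..<n}}" for n
  have X: "X n = PiE {0..<n} (\<lambda>s. {x s})" for n
  proof -
    have "PiE {0..<n} (\<lambda>s. {x s}) = PiE {0..<n} (\<lambda>s. {restrict x {0..<n} s})"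
      by (intro PiE_cong) simp
    also have "\<dots> = {restrict x {0..<n}}"
      by (rule PiE_singleton) (rule restrict_extensional)
    finally show ?thesis by (simp only: X_def)
  qed
  have X_sets[measurable]: "X n \<in> sets (PiM {0..<n} ?N)" for n
    unfolding X by (intro sets_PiM_I_finite) auto
  have sp: "x' \<in> space (PiM {0..<n} ?N) \<longleftrightarrow> x' \<in> extensional {0..<n}" for x' and n :: nat
    by (simp add: space_PiM PiE_def)
  have step: "emeasure (IT.eP n \<omega>) (X (Suc n)) =
      emeasure (chain_kernel A i n (restrict x {0..<n})) {x n} * indicator (X n) \<omega>"
    if w: "\<omega> \<in> space (PiM {0..<n} ?N)" for n \<omega>
  proof -
    have ex: "\<omega> \<in> extensional {0..<n}" using w by (simp add: sp)
    have "(fun_upd \<omega> n) -` X (Suc n) \<inter> space (?N n) = (if \<omega> \<in> X n then {x n} else {})"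
    proof -
      have "fun_upd \<omega> n y \<in> X (Suc n) \<longleftrightarrow> \<omega> \<in> X n \<and> y = x n" for y
      proof -
        have "fun_upd \<omega> n y \<in> X (Suc n) \<longleftrightarrow> (\<forall>s. (fun_upd \<omega> n y) s = restrict x {0..<Suc n} s)"
          by (simp add: X_def fun_eq_iff)
        also have "\<dots> \<longleftrightarrow> y = x n \<and> (\<forall>s. s \<noteq> n \<longrightarrow> \<omega> s = restrict x {0..<n} s)"
          by (auto simp: restrict_def less_Suc_eq)
        also have "\<dots> \<longleftrightarrow> y = x n \<and> (\<forall>s. \<omega> s = restrict x {0..<n} s)"
          using extensional_arb[OF ex, of n] by auto
        also have "\<dots> \<longleftrightarrow> \<omega> \<in> X n \<and> y = x n"
          by (auto simp: X_def fun_eq_iff)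
        finally show ?thesis .
      qed
      then show ?thesis by auto
    qed
    then show ?thesis by (simp add: IT.emeasure_eP[OF w X_sets]) (simp add: X_def)
  qed
  have C: "emeasure (IT.C 0 (Suc n) (\<lambda>_. undefined)) (X (Suc n)) =
    (if x 0 = i then \<Prod>s<n. ennreal (A $ x s $ x (Suc s)) else 0)" for n
  proof -
    have u: "(\<lambda>_. undefined) \<in> space (PiM {0..<0} ?N)" by (simp add: sp)
    have S: "emeasure (IT.C 0 (Suc n) (\<lambda>_. undefined)) (X (Suc n)) =
       emeasure (chain_kernel A i n (restrict x {0..<n})) {x n} *
       emeasure (IT.C 0 n (\<lambda>_. undefined)) (X n)" for n
    proof -
      have "emeasure (IT.C 0 (Suc n) (\<lambda>_. undefined)) (X (Suc n)) =
        (\<integral>\<^sup>+\<omega>. emeasure (IT.eP n \<omega>) (X (Suc n)) \<partial>IT.C 0 n (\<lambda>_. undefined))"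
      proof -
        have "IT.eP n \<in> IT.C 0 n (\<lambda>_. undefined) \<rightarrow>\<^sub>M subprob_algebra (PiM {0..<Suc n} ?N)"
          using IT.measurable_eP[of n] IT.sets_C[OF u, of n]
          by (subst measurable_cong_sets[OF _ refl, of _ "PiM {0..<n} ?N"]) simp_all
        from emeasure_bind[OF prob_space.not_empty[OF IT.prob_space_C[OF u]] this X_sets]
        show ?thesis by simp
      qed
      also have "\<dots> = (\<integral>\<^sup>+\<omega>. emeasure (chain_kernel A i n (restrict x {0..<n})) {x n} *
          indicator (X n) \<omega> \<partial>IT.C 0 n (\<lambda>_. undefined))"
        using IT.space_C[OF u, of n] by (intro nn_integral_cong step) simp
      also have "\<dots> = emeasure (chain_kernel A i n (restrict x {0..<n})) {x n} *
         emeasure (IT.C 0 n (\<lambda>_. undefined)) (X n)"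
        using X_sets[of n] IT.sets_C[OF u, of n] by (subst nn_integral_cmult_indicator) auto
      finally show ?thesis .
    qed
    show ?thesis
    proof (induction n)
      case 0
      show ?case unfolding S[of 0]
        by (auto simp: chain_kernel_def X_def emeasure_return PiM_empty fun_eq_iff indicator_def)
    next
      case (Suc n)
      have "emeasure (chain_kernel A i (Suc n) (restrict x {0..<Suc n})) {x (Suc n)} =
          ennreal (A $ x n $ x (Suc n))"
        by (simp add: chain_kernel_def emeasure_point_measure_finite)
      then show ?case unfolding S[of "Suc n"] Suc.IH by (simp add: mult.commute)
    qed
  qed
  have "{\<omega>. \<forall>s\<le>t. \<omega> s = x s} = prod_emb UNIV ?N {0..<Suc t} (X (Suc t))"
  proof -
    have "(\<forall>s\<le>t. \<omega> s = x s) \<longleftrightarrow> restrict \<omega> {0..<Suc t} = restrict x {0..<Suc t}" for \<omega>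
    proof
      assume *: "restrict \<omega> {0..<Suc t} = restrict x {0..<Suc t}"
      show "\<forall>s\<le>t. \<omega> s = x s"
      proof (intro allI impI)
        show "\<omega> s = x s" if "s \<le> t" for s
          using fun_cong[OF *, of s] that by simp
      qed
    qed (auto simp: restrict_def)
    then show ?thesis by (simp add: prod_emb_def X_def space_PiM vimage_def)
  qed
  then have "emeasure (markov_chain A i) {\<omega>. \<forall>s\<le>t. \<omega> s = x s} = emeasure (IT.CI {0..<Suc t}) (X (Suc t))"
    unfolding markov_chain_def using IT.lim[of "{0..<Suc t}" "X (Suc t)"] by simp
  also have "\<dots> = emeasure (IT.C 0 (Suc t) (\<lambda>_. undefined)) (X (Suc t))"
  proof -
    have "X (Suc t) \<subseteq> PiE {0..<Suc t} (\<lambda>i. space (?N i))"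
      by (simp add: X_def)
    then have "prod_emb {0..<Suc t} ?N {0..<Suc t} (X (Suc t)) = X (Suc t)"
      by (rule prod_emb_id)
    then show ?thesis
      by (subst IT.emeasure_CI[of _ "Suc t"]) (simp_all del: IT.C.simps)
  qed
  finally show ?thesis unfolding C .
qed

text \<open>\<open>hitting_time A i j\<close> is the expectation of the first time \<open>t \<ge> 0\<close> at which the chain started
  at \<open>i\<close> is in \<open>j\<close>; the infimum is \<open>\<infinity>\<close> on paths that never visit \<open>j\<close>, and \<open>0\<close> if \<open>i = j\<close>.\<close>

definition hitting_time :: "real ^ 'n ^ 'n::finite \<Rightarrow> 'n \<Rightarrow> 'n \<Rightarrow> ennreal" where
  "hitting_time A i j = (\<integral>\<^sup>+\<omega>. (INF t\<in>{t. \<omega> t = j}. of_nat t) \<partial>markov_chain A i)"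

definition stationary_distribution :: "real ^ 'n ^ 'n::finite \<Rightarrow> real ^ 'n" where
  "stationary_distribution A =
     (THE \<pi>. (\<forall>i. 0 \<le> \<pi> $ i) \<and> (\<Sum>i\<in>UNIV. \<pi> $ i) = 1 \<and> \<pi> v* A = \<pi>)"

text \<open>Meaningful for irreducible stochastic \<open>A\<close>, where the stationary distribution is unique and the
  sum does not depend on the starting state \<open>i\<close>.\<close>

definition kemeny :: "real ^ 'n ^ 'n::finite \<Rightarrow> ennreal" where
  "kemeny A = (THE K. \<forall>i. K =
     (\<Sum>j\<in>UNIV. ennreal (stationary_distribution A $ j) * hitting_time A i j))"

end

theory Submission
  imports Defs
begin

text \<open>Write \<open>P\<close> for the formation matrix, \<open>J\<close> for the matrix with all entries \<open>1/n\<close>, and \<open>x\<close> for the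
  difference between the positions and a fixed formation. Subtracting the formation turns the update
  into \<open>x(t+1) = P x(t) + n(t)\<close>, and the deviation from the formation with the same centroid is
  \<open>y(t) = (P^t - J) x(0) + (\<Sum>s<t. (P^(t-1-s) - J) n(s))\<close>. The noise terms are pairwise uncorrelated and
  \<open>P\<close> is symmetric, so
  \<open>E \<parallel>y(t)\<parallel>\<^sup>2 = \<parallel>(P^t - J) x(0)\<parallel>\<^sup>2 + d \<lambda>\<^sup>2 (\<Sum>s<t. tr (P^(2s) - J))\<close>.
  On vectors of mean zero \<open>P\<close> is a strict contraction: the Dirichlet form of \<open>P\<^sup>2\<close> vanishes only on
  constant vectors, because the diagonal of \<open>P\<close> is positive and the graph is connected. Hence the first
  term vanishes in the limit and the sum converges to the trace of \<open>Z = (\<Sum>s. (P\<^sup>2)^s - J)\<close>. Finally,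
  \<open>H(i \<rightarrow> j) = n (Z\<^sub>j\<^sub>j - Z\<^sub>i\<^sub>j)\<close> for the chain \<open>P\<^sup>2\<close>, whose stationary distribution is uniform, and the rows of
  \<open>Z\<close> sum to zero, so the Kemeny constant is the trace of \<open>Z\<close>.\<close>

subsection \<open>Powers of symmetric stochastic matrices\<close>

primrec matpow :: "real ^ 'n ^ 'n::finite \<Rightarrow> nat \<Rightarrow> real ^ 'n ^ 'n" where
  "matpow A 0 = mat 1"
| "matpow A (Suc t) = A ** matpow A t"

lemma matpow_add: "matpow A (s + t) = matpow A s ** matpow A t"
  by (induction s) (simp_all add: matrix_mul_assoc)

lemma matpow_square: "matpow (A ** A) s = matpow A (2 * s)"
  by (induction s) (simp_all add: matrix_mul_assoc)

lemma matpow_Suc_nth: "matpow A (Suc t) $ i $ j = (\<Sum>k\<in>UNIV. A $ i $ k * matpow A t $ k $ j)"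
  by (simp add: matrix_matrix_mult_def)

lemma transpose_matpow:
  assumes "transpose A = A"
  shows "transpose (matpow A t) = matpow A t"
proof (induction t)
  case (Suc t)
  have "transpose (matpow A (Suc t)) = matpow A t ** matpow A 1"
    by (simp add: matrix_transpose_mul Suc assms)
  also have "\<dots> = matpow A (Suc t)"
    by (simp only: matpow_add[symmetric]) simp
  finally show ?case .
qed simp

lemma symmetric_nth:
  assumes "transpose A = A"
  shows "A $ i $ j = A $ j $ i"
  by (metis assms transpose_def vec_lambda_beta)

lemma stochastic_mult:
  assumes "stochastic A" "stochastic B"
  shows "stochastic (A ** B)"
proof -
  have "(\<Sum>j\<in>UNIV. \<Sum>k\<in>UNIV. A $ i $ k * B $ k $ j) = (\<Sum>k\<in>UNIV. A $ i $ k * (\<Sum>j\<in>UNIV. B $ k $ j))" for i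
    by (subst sum.swap) (simp add: sum_distrib_left)
  then show ?thesis
    using assms by (auto simp: stochastic_def matrix_matrix_mult_def intro!: sum_nonneg)
qed

lemma stochastic_matpow:
  assumes "stochastic A"
  shows "stochastic (matpow A t)"
proof (induction t)
  case 0
  then show ?case by (auto simp: stochastic_def mat_def)
next
  case (Suc t)
  then show ?case by (simp add: stochastic_mult assms)
qed

text \<open>Expanding the square leaves two diagonal sums, each equal to
  \<open>x \<bullet> x\<close>: one because the rows of \<open>A\<close> sum to one, the other
  because by symmetry the columns do.\<close>

lemma dirichlet_form:
  fixes x :: "real ^ 'n::finite"
  assumes st: "stochastic A" and sym: "transpose A = A"
  shows "(\<Sum>i\<in>UNIV. \<Sum>j\<in>UNIV. A $ i $ j * (x $ i - x $ j)\<^sup>2) = 2 * (x \<bullet> x - x \<bullet> (A *v x))"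
proof -
  have row: "(\<Sum>j\<in>UNIV. A $ i $ j) = 1" for i
    using st by (simp add: stochastic_def)
  have "(\<Sum>i\<in>UNIV. \<Sum>j\<in>UNIV. A $ i $ j * (x $ i - x $ j)\<^sup>2) =
      (\<Sum>i\<in>UNIV. \<Sum>j\<in>UNIV. A $ i $ j * (x $ i)\<^sup>2) + (\<Sum>i\<in>UNIV. \<Sum>j\<in>UNIV. A $ i $ j * (x $ j)\<^sup>2)
      - 2 * (\<Sum>i\<in>UNIV. \<Sum>j\<in>UNIV. x $ i * (A $ i $ j * x $ j))"
    by (simp add: power2_diff algebra_simps sum.distrib sum_subtractf sum_distrib_left)
  also have "(\<Sum>i\<in>UNIV. \<Sum>j\<in>UNIV. A $ i $ j * (x $ j)\<^sup>2) = (\<Sum>j\<in>UNIV. \<Sum>i\<in>UNIV. A $ j $ i * (x $ j)\<^sup>2)"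
    by (subst sum.swap) (simp add: symmetric_nth[OF sym])
  also have "(\<Sum>i\<in>UNIV. \<Sum>j\<in>UNIV. A $ i $ j * (x $ i)\<^sup>2) = x \<bullet> x"
    by (simp add: sum_distrib_right[symmetric] row inner_vec_def power2_eq_square)
  also have "(\<Sum>i\<in>UNIV. \<Sum>j\<in>UNIV. x $ i * (A $ i $ j * x $ j)) = x \<bullet> (A *v x)"
    by (simp add: inner_vec_def matrix_vector_mult_def sum_distrib_left)
  finally show ?thesis by simp
qed

text \<open>By symmetry the columns of \<open>A\<close> sum to one. Mean-zero vectors thus stay
  mean-zero, which is what iterating the contraction requires.\<close>

lemma sum_symmetric_stochastic_mult:
  assumes st: "stochastic A" and sym: "transpose A = A"
  shows "(\<Sum>i\<in>UNIV. (A *v x) $ i) = (\<Sum>i\<in>UNIV. x $ i)"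
proof -
  have "(\<Sum>i\<in>UNIV. (A *v x) $ i) = (\<Sum>j\<in>UNIV. (\<Sum>i\<in>UNIV. A $ j $ i) * x $ j)"
    unfolding matrix_vector_mult_def
    by (simp, subst sum.swap, simp add: sum_distrib_right symmetric_nth[OF sym])
  then show ?thesis using st by (simp add: stochastic_def)
qed

text \<open>On unit vectors the loss of squared norm under \<open>P\<close> is half the Dirichlet
  form of \<open>P ** P\<close>, which is positive when the mean is zero; compactness makes the
  bound uniform. The assumption \<open>conn\<close> expresses irreducibility: a function that agrees
  across all positive entries is constant.\<close>

lemma symmetric_stochastic_contraction:
  fixes P :: "real ^ 'n ^ 'n::finite"
  assumes st: "stochastic P" and sym: "transpose P = P"
    and diag: "\<And>i. 0 < P $ i $ i"
    and conn: "\<And>x :: 'n \<Rightarrow> real. (\<And>i j. 0 < P $ i $ j \<Longrightarrow> x i = x j) \<Longrightarrow> (\<And>i j. x i = x j)"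
  obtains \<rho> where "0 \<le> \<rho>" "\<rho> < 1"
    "\<And>x. (\<Sum>i\<in>UNIV. x $ i) = 0 \<Longrightarrow> norm (P *v x) \<le> \<rho> * norm x"
proof -
  define S where "S = {x::real^'n. (\<Sum>i\<in>UNIV. x $ i) = 0} \<inter> sphere 0 1"
  have nonneg: "0 \<le> P $ i $ j" for i j
    using st by (simp add: stochastic_def)
  have strict: "norm (P *v x) < 1" if "x \<in> S" for x
  proof -
    have "transpose (P ** P) = P ** P"
      by (simp add: matrix_transpose_mul sym)
    from dirichlet_form[OF stochastic_mult[OF st st] this]
    have D: "(\<Sum>i\<in>UNIV. \<Sum>j\<in>UNIV. (P ** P) $ i $ j * (x $ i - x $ j)\<^sup>2) = 2 * (x \<bullet> x - x \<bullet> ((P ** P) *v x))" .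
    have "x \<bullet> ((P ** P) *v x) = (P *v x) \<bullet> (P *v x)"
      using dot_lmul_matrix[of x P "P *v x"] vector_transpose_matrix[of x P] sym
      by (simp add: matrix_vector_mul_assoc)
    then have E: "2 * (1 - (norm (P *v x))\<^sup>2) = (\<Sum>i\<in>UNIV. \<Sum>j\<in>UNIV. (P ** P) $ i $ j * (x $ i - x $ j)\<^sup>2)"
      using that unfolding D by (simp add: S_def dot_square_norm)
    have PP: "0 \<le> (P ** P) $ i $ j" for i j
      using stochastic_mult[OF st st] by (simp add: stochastic_def)
    have "\<not> (\<Sum>i\<in>UNIV. \<Sum>j\<in>UNIV. (P ** P) $ i $ j * (x $ i - x $ j)\<^sup>2) \<le> 0"
    proof
      assume "(\<Sum>i\<in>UNIV. \<Sum>j\<in>UNIV. (P ** P) $ i $ j * (x $ i - x $ j)\<^sup>2) \<le> 0"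
      then have "(\<Sum>i\<in>UNIV. \<Sum>j\<in>UNIV. (P ** P) $ i $ j * (x $ i - x $ j)\<^sup>2) = 0"
        by (intro antisym sum_nonneg mult_nonneg_nonneg PP) auto
      then have z: "(P ** P) $ i $ j * (x $ i - x $ j)\<^sup>2 = 0" for i j
        using PP by (simp add: sum_nonneg_eq_0_iff sum_nonneg)
      \<comment> \<open>The two-step path that first stays at \<open>i\<close> and then moves to
        \<open>j\<close> has positive weight, since the diagonal is positive.\<close>
      have "x $ i = x $ j" if "0 < P $ i $ j" for i j
      proof -
        have "0 < P $ i $ i * P $ i $ j"
          using that diag by simp
        also have "\<dots> \<le> (P ** P) $ i $ j"
          unfolding matrix_matrix_mult_def using nonneg by (auto intro!: member_le_sum)
        finally show ?thesis using z[of i j] by simp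
      qed
      from conn[of "($) x", OF this] have c: "x $ i = x $ j" for i j by blast
      have "x $ i = 0" for i
      proof -
        have "0 = (\<Sum>j\<in>UNIV. x $ j)" using that by (simp add: S_def)
        also have "\<dots> = (\<Sum>j\<in>(UNIV::'n set). x $ i)" by (intro sum.cong c refl)
        finally show ?thesis by simp
      qed
      then have "x = 0" by (simp add: vec_eq_iff)
      then show False using that by (simp add: S_def)
    qed
    then have "(norm (P *v x))\<^sup>2 < 1\<^sup>2" using E by simp
    then show ?thesis by (rule power_less_imp_less_base) simp
  qed
  have cS: "compact S"
    unfolding S_def by (intro closed_Int_compact closed_Collect_eq continuous_intros) auto
  have "\<exists>\<rho>\<ge>0. \<rho> < 1 \<and> (\<forall>x\<in>S. norm (P *v x) \<le> \<rho>)"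
  \<comment> \<open>With a single index the only mean-zero vector is 0, so \<open>S\<close> can be
    empty; \<rho> = 0 then works vacuously.\<close>
  proof (cases "S = {}")
    case False
    have "continuous_on S (\<lambda>x. norm (P *v x))"
      by (intro continuous_intros linear_continuous_on matrix_vector_mul_bounded_linear)
    from continuous_attains_sup[OF cS False this] obtain x0 where
      "x0 \<in> S" "\<forall>x\<in>S. norm (P *v x) \<le> norm (P *v x0)" by blast
    then show ?thesis using strict by (intro exI[of _ "norm (P *v x0)"]) auto
  qed (auto intro: exI[of _ 0])
  then obtain \<rho> where \<rho>: "0 \<le> \<rho>" "\<rho> < 1" "\<And>x. x \<in> S \<Longrightarrow> norm (P *v x) \<le> \<rho>" by blast
  show thesis
  proof (rule that[OF \<rho>(1,2)])
    fix x :: "real^'n" assume x: "(\<Sum>i\<in>UNIV. x $ i) = 0"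
    show "norm (P *v x) \<le> \<rho> * norm x"
    proof (cases "x = 0")
      case False
      have "(1 / norm x) *\<^sub>R x \<in> S"
        using x False by (simp add: S_def sum_distrib_left[symmetric] sum_divide_distrib[symmetric])
      from \<rho>(3)[OF this] have "norm (P *v x) / norm x \<le> \<rho>"
        by (simp add: matrix_vector_mult_scaleR)
      then show ?thesis using False by (simp add: field_simps)
    qed simp
  qed
qed

text \<open>Column \<open>j\<close> of \<open>matpow P t\<close> minus the uniform column is
  \<open>matpow P t\<close> applied to \<open>axis j 1\<close> with its mean removed, and the
  contraction applies at every step. The factor 2 bounds the norm of that starting vector.\<close>

lemma symmetric_stochastic_geometric:
  fixes P :: "real ^ 'n ^ 'n::finite"
  assumes st: "stochastic P" and sym: "transpose P = P"
    and diag: "\<And>i. 0 < P $ i $ i"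
    and conn: "\<And>x :: 'n \<Rightarrow> real. (\<And>i j. 0 < P $ i $ j \<Longrightarrow> x i = x j) \<Longrightarrow> (\<And>i j. x i = x j)"
  obtains \<rho> where "0 \<le> \<rho>" "\<rho> < 1"
    "\<And>t i j. \<bar>matpow P t $ i $ j - 1 / real CARD('n)\<bar> \<le> 2 * \<rho> ^ t"
proof -
  obtain \<rho> where \<rho>: "0 \<le> \<rho>" "\<rho> < 1"
    and contr: "\<And>x. (\<Sum>i\<in>UNIV. x $ i) = 0 \<Longrightarrow> norm (P *v x) \<le> \<rho> * norm x"
    using symmetric_stochastic_contraction[OF st sym diag conn] by metis
  have pow: "norm (matpow P t *v x) \<le> \<rho> ^ t * norm x" if "(\<Sum>i\<in>UNIV. x $ i) = 0" for t x
  proof (induction t)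
    case (Suc t)
    have "norm (matpow P (Suc t) *v x) = norm (P *v (matpow P t *v x))"
      by (simp add: matrix_vector_mul_assoc)
    also have "\<dots> \<le> \<rho> * norm (matpow P t *v x)"
      using that by (intro contr)
        (simp add: sum_symmetric_stochastic_mult stochastic_matpow transpose_matpow st sym)
    also have "\<dots> \<le> \<rho> * (\<rho> ^ t * norm x)"
      by (intro mult_left_mono Suc \<rho>)
    finally show ?case by simp
  qed simp
  have "\<bar>matpow P t $ i $ j - 1 / real CARD('n)\<bar> \<le> 2 * \<rho> ^ t" for t i j
  proof -
    define x :: "real^'n" where "x = axis j 1 - vec (1 / real CARD('n))"
    have "norm (vec (1 / real CARD('n)) :: real^'n) \<le> (\<Sum>i\<in>(UNIV::'n set). \<bar>1 / real CARD('n)\<bar>)"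
      using norm_le_l1_cart[of "vec (1 / real CARD('n)) :: real^'n"] by simp
    then have n: "norm x \<le> 2"
      unfolding x_def using norm_triangle_ineq4[of "axis j (1::real)" "vec (1 / real CARD('n))"]
      by simp
    have s: "(\<Sum>i\<in>UNIV. x $ i) = 0"
      by (simp add: x_def sum_subtractf axis_def)
    have "(matpow P t *v x) $ i = matpow P t $ i $ j - 1 / real CARD('n)"
      using stochastic_matpow[OF st, of t]
      by (simp add: x_def matrix_vector_mult_def axis_def stochastic_def right_diff_distrib
          sum_subtractf sum_divide_distrib[symmetric] if_distrib[of "(*) _"] cong: if_cong)
    then have "\<bar>matpow P t $ i $ j - 1 / real CARD('n)\<bar> \<le> \<rho> ^ t * norm x"
      using component_le_norm_cart[of "matpow P t *v x" i] pow[OF s, of t] by simp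
    also have "\<dots> \<le> \<rho> ^ t * 2"
      using n \<rho> by (intro mult_left_mono) auto
    finally show ?thesis by simp
  qed
  with \<rho> show thesis by (intro that)
qed


subsection \<open>Hitting times as survival sums\<close>

text \<open>Backward transition operator of the chain killed at \<open>j\<close>. Iterating it on
  the indicator of the complement of \<open>j\<close> yields the probabilities of not yet having
  visited \<open>j\<close>.\<close>

definition killed_step :: "real ^ 'n ^ 'n::finite \<Rightarrow> 'n \<Rightarrow> ('n \<Rightarrow> real) \<Rightarrow> 'n \<Rightarrow> real" where
  "killed_step A j \<phi> i = (if i = j then 0 else \<Sum>k\<in>UNIV. A $ i $ k * \<phi> k)"

lemma sum_PiE_atMost_Suc:
  fixes F :: "(nat \<Rightarrow> 'a) \<Rightarrow> real"
  assumes "finite B"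
  shows "(\<Sum>x\<in>PiE {..Suc t} (\<lambda>_. B). F x) = (\<Sum>x\<in>PiE {..t} (\<lambda>_. B). \<Sum>k\<in>B. F (x(Suc t := k)))"
proof -
  have "PiE {..Suc t} (\<lambda>_. B) = (\<lambda>(y, g). g(Suc t := y)) ` (B \<times> PiE {..t} (\<lambda>_. B))"
    by (simp add: atMost_Suc PiE_insert_eq)
  moreover have "inj_on (\<lambda>(y, g). g(Suc t := y)) (B \<times> PiE {..t} (\<lambda>_. B))"
    by (rule inj_combinator) simp
  ultimately have "(\<Sum>x\<in>PiE {..Suc t} (\<lambda>_. B). F x) = (\<Sum>(k, x)\<in>B \<times> PiE {..t} (\<lambda>_. B). F (x(Suc t := k)))"
    by (simp only: sum.reindex) (simp add: case_prod_unfold)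
  also have "\<dots> = (\<Sum>k\<in>B. \<Sum>x\<in>PiE {..t} (\<lambda>_. B). F (x(Suc t := k)))"
    by (simp add: sum.cartesian_product)
  finally show ?thesis by (simp add: sum.swap[of _ B])
qed

text \<open>The last transition of a path is absorbed into \<phi>, which is therefore generalised in
  the induction. Since \<phi> vanishes at \<open>j\<close>, summing over last states other than
  \<open>j\<close> gives the full sum in \<open>killed_step\<close>.\<close>

lemma sum_paths_killed_step:
  assumes "\<phi> j = 0"
  shows "(\<Sum>x\<in>PiE {..t} (\<lambda>_. - {j}). (if x 0 = i then \<Prod>s<t. A $ x s $ x (Suc s) else 0) * \<phi> (x t)) =
    (killed_step A j ^^ t) \<phi> i"
  using assms
proof (induction t arbitrary: \<phi>)
  case 0
  \<comment> \<open>Extensional functions are \<open>undefined\<close> off their index set, so a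
    path with one state is determined by its value at 0.\<close>
  have eq: "x = (\<lambda>_. undefined)(0 := x 0)" if "x \<in> PiE {..0::nat} (\<lambda>_. - {j})" for x
    using PiE_arb[OF that] by (intro ext) simp
  have "(\<Sum>x\<in>PiE {..0::nat} (\<lambda>_. - {j}). (if x 0 = i then 1 else 0) * \<phi> (x 0)) =
      (\<Sum>y\<in>- {j}. if y = i then \<phi> i else 0)"
  proof (rule sum.reindex_bij_witness[of _ "\<lambda>y. (\<lambda>_. undefined)(0 := y)" "\<lambda>x. x 0"])
    fix x :: "nat \<Rightarrow> 'a" assume x: "x \<in> PiE {..0} (\<lambda>_. - {j})"
    show "(\<lambda>_. undefined)(0 := x 0) = x" by (rule eq[OF x, symmetric])
    show "x 0 \<in> - {j}" using PiE_mem[OF x, of 0] by simp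
  qed (auto simp: PiE_iff extensional_def)
  then show ?case using 0 by (auto cong: if_cong)
next
  case (Suc t)
  have kj: "killed_step A j \<phi> j = 0" by (simp add: killed_step_def)
  have "(\<Sum>x\<in>PiE {..Suc t} (\<lambda>_. - {j}). (if x 0 = i then \<Prod>s<Suc t. A $ x s $ x (Suc s) else 0) * \<phi> (x (Suc t)))
     = (\<Sum>x\<in>PiE {..t} (\<lambda>_. - {j}). (if x 0 = i then \<Prod>s<t. A $ x s $ x (Suc s) else 0) *
          killed_step A j \<phi> (x t))"
  proof (subst sum_PiE_atMost_Suc, simp, rule sum.cong[OF refl])
    fix x assume x: "x \<in> PiE {..t} (\<lambda>_. - {j})"
    then have xt: "x t \<noteq> j" by auto
    have "(\<Prod>s<Suc t. A $ (x(Suc t := k)) s $ (x(Suc t := k)) (Suc s)) = (\<Prod>s<t. A $ x s $ x (Suc s)) * A $ x t $ k" for k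
      by (simp add: prod.lessThan_Suc)
    moreover have "(\<Sum>k\<in>- {j}. A $ x t $ k * \<phi> k) = killed_step A j \<phi> (x t)"
      using xt Suc.prems by (simp add: killed_step_def, intro sum.mono_neutral_left) auto
    ultimately show "(\<Sum>k\<in>- {j}. (if (x(Suc t := k)) 0 = i then \<Prod>s<Suc t. A $ (x(Suc t := k)) s $ (x(Suc t := k)) (Suc s) else 0) * \<phi> ((x(Suc t := k)) (Suc t)))
       = (if x 0 = i then \<Prod>s<t. A $ x s $ x (Suc s) else 0) * killed_step A j \<phi> (x t)"
      by (simp add: sum_distrib_left[symmetric] mult.assoc)
  qed
  also have "\<dots> = (killed_step A j ^^ t) (killed_step A j \<phi>) i"
    using kj by (rule Suc.IH)
  finally show ?case by (simp add: funpow_swap1)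
qed

lemma sets_markov_chain:
  assumes "stochastic A"
  shows "sets (markov_chain A i) = sets (PiM UNIV (\<lambda>_. count_space UNIV))"
proof -
  interpret IT: Ionescu_Tulcea "chain_kernel A i" "\<lambda>_. count_space UNIV"
    by (rule Ionescu_Tulcea_chain_kernel[OF assms])
  show ?thesis unfolding markov_chain_def by (rule IT.PF.sets_lim)
qed

lemma sets_markov_chain_Collect:
  fixes A :: "real ^ 'n ^ 'n::finite"
  assumes "stochastic A"
  shows "{\<omega>. \<forall>s\<le>t. \<omega> s \<in> B s} \<in> sets (markov_chain A i)"
proof -
  have "{\<omega> \<in> space (PiM UNIV (\<lambda>_::nat. count_space UNIV)). \<forall>s\<in>{..t}. \<omega> s \<in> B s}
      \<in> sets (PiM UNIV (\<lambda>_. count_space (UNIV::'n set)))"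
    by measurable
  then show ?thesis by (simp add: sets_markov_chain[OF assms] space_PiM Ball_def)
qed

text \<open>The event is a finite disjoint union of cylinders, one for each path of
  \<open>t + 1\<close> states avoiding \<open>j\<close>, and \<open>emeasure_markov_chain\<close>
  gives their probabilities.\<close>

lemma emeasure_markov_chain_avoid:
  fixes A :: "real ^ 'n ^ 'n::finite"
  assumes st: "stochastic A"
  shows "emeasure (markov_chain A i) {\<omega>. \<forall>s\<le>t. \<omega> s \<noteq> j} =
    ennreal ((killed_step A j ^^ t) (\<lambda>k. if k = j then 0 else 1) i)"
proof -
  define paths where "paths = PiE {..t} (\<lambda>_::nat. - {j})"
  define C where "C x = {\<omega>. \<forall>s\<le>t. \<omega> s = x s}" for x :: "nat \<Rightarrow> 'n"
  have nonneg: "0 \<le> A $ k $ l" for k l using st by (simp add: stochastic_def)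
  have U: "{\<omega>. \<forall>s\<le>t. \<omega> s \<noteq> j} = (\<Union>x\<in>paths. C x)"
  proof (intro equalityI subsetI)
    fix \<omega> assume "\<omega> \<in> {\<omega>. \<forall>s\<le>t. \<omega> s \<noteq> j}"
    then show "\<omega> \<in> (\<Union>x\<in>paths. C x)"
      by (intro UN_I[of "restrict \<omega> {..t}"]) (auto simp: paths_def C_def)
  qed (auto simp: paths_def C_def)
  have fin: "finite paths" by (auto simp: paths_def intro: finite_PiE)
  have sets: "C x \<in> sets (markov_chain A i)" for x
    using sets_markov_chain_Collect[OF st, of t "\<lambda>s. {x s}"] by (simp add: C_def)
  have disj: "disjoint_family_on C paths"
    unfolding disjoint_family_on_def
  proof (intro ballI impI)
    fix x y assume "x \<in> paths" "y \<in> paths" "x \<noteq> y"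
    then obtain s where "s \<le> t" "x s \<noteq> y s"
      unfolding paths_def by (metis PiE_ext atMost_iff)
    then show "C x \<inter> C y = {}" by (force simp: C_def)
  qed
  have "emeasure (markov_chain A i) {\<omega>. \<forall>s\<le>t. \<omega> s \<noteq> j} = (\<Sum>x\<in>paths. emeasure (markov_chain A i) (C x))"
    unfolding U using fin sets disj by (intro sum_emeasure[symmetric]) auto
  also have "\<dots> = (\<Sum>x\<in>paths. ennreal ((if x 0 = i then \<Prod>s<t. A $ x s $ x (Suc s) else 0) *
      (if x t = j then 0 else 1)))"
  proof (rule sum.cong[OF refl])
    fix x assume "x \<in> paths"
    then have "x t \<noteq> j" by (auto simp: paths_def)
    then show "emeasure (markov_chain A i) (C x) =
      ennreal ((if x 0 = i then \<Prod>s<t. A $ x s $ x (Suc s) else 0) * (if x t = j then 0 else 1))"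
      unfolding C_def by (simp add: emeasure_markov_chain[OF st] prod_ennreal nonneg)
  qed
  also have "\<dots> = ennreal (\<Sum>x\<in>paths. (if x 0 = i then \<Prod>s<t. A $ x s $ x (Suc s) else 0) *
      (if x t = j then 0 else 1))"
    by (rule sum_ennreal) (auto intro: prod_nonneg nonneg)
  finally show ?thesis
    unfolding paths_def by (subst (asm) sum_paths_killed_step) simp_all
qed

text \<open>A time \<open>t\<close> is counted exactly when it lies strictly before the first visit.
  On paths that never reach \<open>j\<close> both sides are \<infinity>.\<close>

lemma INF_hitting_eq_suminf:
  "(INF t\<in>{t. \<omega> t = j}. of_nat t :: ennreal) = (\<Sum>t. indicator {\<omega>. \<forall>s\<le>t. \<omega> s \<noteq> j} \<omega>)"
proof (cases "\<exists>t. \<omega> t = j")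
  case True
  define T where "T = (LEAST t. \<omega> t = j)"
  have T: "\<omega> T = j" and least: "\<And>t. \<omega> t = j \<Longrightarrow> T \<le> t"
    unfolding T_def using True by (auto intro: LeastI_ex Least_le)
  have "(INF t\<in>{t. \<omega> t = j}. of_nat t :: ennreal) = of_nat T"
    using T least by (intro antisym INF_lower INF_greatest) auto
  also have "\<dots> = (\<Sum>t<T. indicator {\<omega>. \<forall>s\<le>t. \<omega> s \<noteq> j} \<omega>)"
  proof -
    have "(\<Sum>t<T. indicator {\<omega>. \<forall>s\<le>t. \<omega> s \<noteq> j} \<omega>) = (\<Sum>t<T. 1::ennreal)"
      using least by (intro sum.cong) (force simp: indicator_def)+
    then show ?thesis by simp
  qed
  also have "\<dots> = (\<Sum>t. indicator {\<omega>. \<forall>s\<le>t. \<omega> s \<noteq> j} \<omega>)"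
    using T by (intro suminf_finite[symmetric]) (auto simp: indicator_def not_less)
  finally show ?thesis .
next
  case False
  then have "(\<Sum>t. indicator {\<omega>. \<forall>s\<le>t. \<omega> s \<noteq> j} \<omega>) = (\<Sum>t::nat. 1::ennreal)"
    by (intro suminf_cong) (auto simp: indicator_def)
  also have "\<dots> = \<top>"
  proof -
    have "(SUP n::nat. of_nat n :: ennreal) = \<top>"
      by (rule ennreal_SUP_of_nat_eq_top)
    then show ?thesis by (simp add: suminf_eq_SUP)
  qed
  finally show ?thesis using False by simp
qed

text \<open>The tail sum is integrated term by term, leaving the survival probabilities.\<close>

lemma hitting_time_eq_suminf:
  assumes st: "stochastic A"
  shows "hitting_time A i j =
    (\<Sum>t. ennreal ((killed_step A j ^^ t) (\<lambda>k. if k = j then 0 else 1) i))"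
proof -
  have "hitting_time A i j = (\<integral>\<^sup>+\<omega>. (\<Sum>t. indicator {\<omega>. \<forall>s\<le>t. \<omega> s \<noteq> j} \<omega>) \<partial>markov_chain A i)"
    by (simp only: hitting_time_def INF_hitting_eq_suminf)
  also have "\<dots> = (\<Sum>t. \<integral>\<^sup>+\<omega>. indicator {\<omega>. \<forall>s\<le>t. \<omega> s \<noteq> j} \<omega> \<partial>markov_chain A i)"
    using sets_markov_chain_Collect[OF st, of _ "\<lambda>_. - {j}"]
    by (intro nn_integral_suminf borel_measurable_indicator) simp
  also have "\<dots> = (\<Sum>t. ennreal ((killed_step A j ^^ t) (\<lambda>k. if k = j then 0 else 1) i))"
    using sets_markov_chain_Collect[OF st, of _ "\<lambda>_. - {j}"]
    by (simp add: emeasure_markov_chain_avoid[OF st])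
  finally show ?thesis .
qed

section \<open>First-step equations for expected hitting times\<close>

lemma killed_step_add: "killed_step A j (\<lambda>k. \<phi> k + \<psi> k) = (\<lambda>i. killed_step A j \<phi> i + killed_step A j \<psi> i)"
  by (auto simp: killed_step_def distrib_left sum.distrib)

lemma funpow_killed_step_nonneg:
  assumes "stochastic A" "\<And>k. 0 \<le> \<phi> k"
  shows "0 \<le> (killed_step A j ^^ t) \<phi> i"
  using assms by (induction t arbitrary: i)
    (auto simp: killed_step_def stochastic_def intro!: sum_nonneg)

text \<open>The killed operator is linear and positive, so a pointwise comparison survives
  iteration.\<close>

lemma funpow_killed_step_mono:
  assumes "stochastic A" "\<And>k. \<phi> k \<le> c * \<psi> k"
  shows "(killed_step A j ^^ t) \<phi> i \<le> c * (killed_step A j ^^ t) \<psi> i"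
proof (induction t arbitrary: i)
  case (Suc t)
  have "(\<Sum>k\<in>UNIV. A $ i $ k * (killed_step A j ^^ t) \<phi> k)
      \<le> (\<Sum>k\<in>UNIV. A $ i $ k * (c * (killed_step A j ^^ t) \<psi> k))"
    using assms(1) Suc by (intro sum_mono mult_left_mono) (auto simp: stochastic_def)
  then show ?case by (simp add: killed_step_def[of A j _ i] sum_distrib_left mult.left_commute)
qed (use assms in simp)

text \<open>A nonnegative solution of the first-step equations is the expected hitting time: the remainder
  after \<open>t\<close> steps is dominated by a multiple of the survival probability, which is summable
  because its partial sums are bounded by the solution itself.\<close>

lemma hitting_time_eqI:
  fixes g :: "'n::finite \<Rightarrow> real"
  assumes st: "stochastic A" and nonneg: "\<And>i. 0 \<le> g i" and zero: "g j = 0"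
    and step: "\<And>i. i \<noteq> j \<Longrightarrow> g i = 1 + (\<Sum>k\<in>UNIV. A $ i $ k * g k)"
  shows "hitting_time A i j = ennreal (g i)"
proof -
  define u where "u = (\<lambda>t. (killed_step A j ^^ t) (\<lambda>k. if k = j then 0 else 1))"
  \<comment> \<open>The first-step equations and the value 0 at \<open>j\<close> merge into one
    fixed-point equation with source term \<open>u 0\<close>.\<close>
  have g: "g = (\<lambda>i. u 0 i + killed_step A j g i)"
  proof
    fix i show "g i = u 0 i + killed_step A j g i"
    proof (cases "i = j")
      case False
      then have "u 0 i = 1" "killed_step A j g i = (\<Sum>k\<in>UNIV. A $ i $ k * g k)"
        by (simp_all add: u_def killed_step_def)
      then show ?thesis by (metis step[OF False])
    qed (simp add: u_def killed_step_def zero)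
  qed
  have powadd: "(killed_step A j ^^ t) (\<lambda>i. \<phi> i + \<psi> i) =
      (\<lambda>i. (killed_step A j ^^ t) \<phi> i + (killed_step A j ^^ t) \<psi> i)" for t \<phi> \<psi>
    by (induction t) (simp_all add: killed_step_add)
  \<comment> \<open>Iterating the fixed-point equation: the survival terms of the first
    \<open>t\<close> times plus a remainder.\<close>
  have split: "g i = (\<Sum>s<t. u s i) + (killed_step A j ^^ t) g i" for t i
  proof (induction t)
    case (Suc t)
    have "(killed_step A j ^^ t) g = (\<lambda>i. u t i + (killed_step A j ^^ Suc t) g i)"
    proof -
      have "(killed_step A j ^^ t) g = (killed_step A j ^^ t) (\<lambda>i. u 0 i + killed_step A j g i)"
        using g by (rule arg_cong)
      also have "\<dots> = (\<lambda>i. (killed_step A j ^^ t) (u 0) i + (killed_step A j ^^ t) (killed_step A j g) i)"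
        by (rule powadd)
      also have "(killed_step A j ^^ t) (u 0) = u t"
        by (simp add: u_def)
      also have "(killed_step A j ^^ t) (killed_step A j g) = (killed_step A j ^^ Suc t) g"
        by (simp only: funpow_Suc_right o_apply)
      finally show ?thesis .
    qed
    then have "(killed_step A j ^^ t) g i = u t i + (killed_step A j ^^ Suc t) g i"
      by (rule fun_cong)
    with Suc show ?case unfolding sum.lessThan_Suc by linarith
  qed simp
  have u_nonneg: "0 \<le> u t i" for t i
    unfolding u_def by (rule funpow_killed_step_nonneg[OF st]) simp
  have rem_nonneg: "0 \<le> (killed_step A j ^^ t) g i" for t i
    by (rule funpow_killed_step_nonneg[OF st nonneg])
  have partial: "(\<Sum>s<t. u s i) = g i - (killed_step A j ^^ t) g i" for t
    using split[of i t] by linarith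
  then have "(\<Sum>s<t. u s i) \<le> g i" for t
    using rem_nonneg[of t i] by simp
  then have summable: "summable (\<lambda>s. u s i)"
    by (intro bounded_imp_summable[of _ "g i"] u_nonneg) (metis lessThan_Suc_atMost)
  define c where "c = Max (range g)"
  have c: "g k \<le> c" for k by (simp add: c_def)
  \<comment> \<open>At \<open>j\<close> the initial comparison holds because \<open>g j = 0\<close>,
    elsewhere because \<open>c\<close> is the maximum of \<open>g\<close>.\<close>
  have le: "(killed_step A j ^^ t) g i \<le> c * u t i" for t
    unfolding u_def using c zero by (intro funpow_killed_step_mono[OF st]) auto
  have "(\<lambda>t. c * u t i) \<longlonglongrightarrow> 0"
    using tendsto_mult_right_zero[OF summable_LIMSEQ_zero[OF summable]] .
  then have "(\<lambda>t. (killed_step A j ^^ t) g i) \<longlonglongrightarrow> 0"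
    by (rule tendsto_sandwich[OF always_eventually[OF allI[OF rem_nonneg]]
        always_eventually[OF allI[OF le]] tendsto_const])
  from tendsto_diff[OF tendsto_const this]
  have "(\<lambda>t. g i - (killed_step A j ^^ t) g i) \<longlonglongrightarrow> g i"
    by (simp only: diff_zero)
  then have "(\<lambda>s. u s i) sums g i"
    unfolding sums_def partial .
  then have "(\<Sum>t. ennreal (u t i)) = ennreal (g i)"
    by (rule suminf_ennreal_eq[OF u_nonneg])
  then show ?thesis by (simp add: hitting_time_eq_suminf[OF st] u_def)
qed


subsection \<open>The Kemeny constant of a symmetric chain\<close>

text \<open>Mixing enters as summability of the deviations of the powers from the uniform matrix; in
  particular the powers converge to it.\<close>

locale symmetric_mixing_chain =
  fixes A :: "real ^ 'n ^ 'n::finite"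
  assumes st: "stochastic A" and sym: "transpose A = A"
    and summable_dev: "\<And>i j. summable (\<lambda>t. matpow A t $ i $ j - 1 / real CARD('n))"
begin

text \<open>The deviation matrix, or group inverse of \<open>I - A\<close>. It differs by
  \<open>J\<close> from the Kemeny-Snell fundamental matrix.\<close>

definition fundamental :: "'n \<Rightarrow> 'n \<Rightarrow> real" where
  "fundamental i j = (\<Sum>t. matpow A t $ i $ j - 1 / real CARD('n))"

lemma sum_row: "(\<Sum>j\<in>UNIV. A $ i $ j) = 1"
  using st by (simp add: stochastic_def)

text \<open>Every term of the series has zero row sums. This removes the starting state from the
  Kemeny sum.\<close>

lemma sum_fundamental: "(\<Sum>j\<in>UNIV. fundamental i j) = 0"
proof -
  have "(\<Sum>j\<in>UNIV. fundamental i j) = (\<Sum>t. \<Sum>j\<in>UNIV. matpow A t $ i $ j - 1 / real CARD('n))"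
    unfolding fundamental_def by (rule suminf_sum[symmetric]) (rule summable_dev)
  also have "\<dots> = (\<Sum>t. 0)"
    using stochastic_matpow[OF st] by (simp add: sum_subtractf stochastic_def)
  finally show ?thesis by simp
qed

text \<open>The entrywise form of \<open>Z = I - J + A Z\<close>: the term at time 0 is split off,
  and \<open>1/n\<close> passes through the average because the rows of \<open>A\<close> sum to
  one.\<close>

lemma fundamental_step:
  "fundamental i j = (if i = j then 1 else 0) - 1 / real CARD('n) + (\<Sum>k\<in>UNIV. A $ i $ k * fundamental k j)"
proof -
  have "fundamental i j = (matpow A 0 $ i $ j - 1 / real CARD('n)) + (\<Sum>t. matpow A (Suc t) $ i $ j - 1 / real CARD('n))"
    unfolding fundamental_def by (subst suminf_split_head[OF summable_dev]) simp
  also have "(\<lambda>t. matpow A (Suc t) $ i $ j - 1 / real CARD('n)) =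
      (\<lambda>t. \<Sum>k\<in>UNIV. A $ i $ k * (matpow A t $ k $ j - 1 / real CARD('n)))"
    by (simp only: matpow_Suc_nth right_diff_distrib sum_subtractf sum_distrib_right[symmetric] sum_row mult_1)
  also have "(\<Sum>t. \<Sum>k\<in>UNIV. A $ i $ k * (matpow A t $ k $ j - 1 / real CARD('n))) =
      (\<Sum>k\<in>UNIV. A $ i $ k * fundamental k j)"
    unfolding fundamental_def
    by (subst suminf_sum) (auto intro!: summable_mult summable_dev suminf_mult sum.cong)
  finally show ?thesis by (simp add: mat_def)
qed

text \<open>Nonnegativity is the minimum principle: away from \<open>j\<close> the value exceeds a weighted average of all
  values by \<open>1\<close>, so the minimum is attained at \<open>j\<close>.\<close>

lemma hitting_time_eq_fundamental:
  "hitting_time A i j = ennreal (real CARD('n) * (fundamental j j - fundamental i j))"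
  and fundamental_diff_nonneg: "0 \<le> real CARD('n) * (fundamental j j - fundamental i j)"
proof -
  define g where "g i = real CARD('n) * (fundamental j j - fundamental i j)" for i
  have avg: "(\<Sum>k\<in>UNIV. A $ i $ k * g k) =
      real CARD('n) * (fundamental j j - (\<Sum>k\<in>UNIV. A $ i $ k * fundamental k j))" for i
  proof -
    have "(\<Sum>k\<in>UNIV. A $ i $ k * g k) = real CARD('n) * (\<Sum>k\<in>UNIV. A $ i $ k * fundamental j j - A $ i $ k * fundamental k j)"
      by (simp add: g_def sum_distrib_left algebra_simps)
    then show ?thesis
      by (simp only: sum_subtractf sum_distrib_right[symmetric] sum_row mult_1)
  qed
  \<comment> \<open>Off the diagonal the recursion for \<open>fundamental\<close> loses
    \<open>1/n\<close> per step; scaling by \<open>n\<close> turns this into one unit of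
    time.\<close>
  have step: "g i = 1 + (\<Sum>k\<in>UNIV. A $ i $ k * g k)" if "i \<noteq> j" for i
    unfolding avg using that by (subst g_def, subst fundamental_step[of i j]) (simp add: field_simps)
  have zero: "g j = 0" by (simp add: g_def)
  obtain m where m: "\<And>k. g m \<le> g k"
  proof -
    have "Min (range g) \<in> range g" by (rule Min_in) auto
    then obtain m where "g m = Min (range g)" by (auto simp: image_iff)
    then have "g m \<le> g k" for k by simp
    then show thesis by (rule that)
  qed
  have "m = j"
  proof (rule ccontr)
    assume "m \<noteq> j"
    have "g m = (\<Sum>k\<in>UNIV. A $ m $ k * g m)"
      by (simp only: sum_distrib_right[symmetric] sum_row mult_1)
    also have "\<dots> \<le> (\<Sum>k\<in>UNIV. A $ m $ k * g k)"
      using st m by (intro sum_mono mult_left_mono) (auto simp: stochastic_def)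
    finally show False using step[OF \<open>m \<noteq> j\<close>] by linarith
  qed
  then have nonneg: "0 \<le> g k" for k using m[of k] zero by simp
  show "hitting_time A i j = ennreal (real CARD('n) * (fundamental j j - fundamental i j))"
    using hitting_time_eqI[OF st nonneg zero step, of i] by (simp add: g_def)
  show "0 \<le> real CARD('n) * (fundamental j j - fundamental i j)"
    using nonneg[of i] by (simp add: g_def)
qed

text \<open>The columns sum to one, so the uniform vector is stationary. It is the only one: a
  stationary vector is fixed by all powers, which converge to the uniform matrix.\<close>

lemma stationary_distribution_eq: "stationary_distribution A = vec (1 / real CARD('n))"
  unfolding stationary_distribution_def
proof (rule the_equality)
  have "(\<Sum>i\<in>UNIV. A $ i $ j) = 1" for j
    using sum_row[of j] by (simp add: symmetric_nth[OF sym])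
  then show "(\<forall>i. 0 \<le> vec (1 / real CARD('n)) $ i) \<and> (\<Sum>i\<in>(UNIV::'n set). vec (1 / real CARD('n)) $ i) = 1 \<and>
      vec (1 / real CARD('n)) v* A = vec (1 / real CARD('n))"
    by (simp add: vec_eq_iff vector_matrix_mult_def sum_divide_distrib[symmetric])
next
  fix \<pi> :: "real ^ 'n"
  assume \<pi>: "(\<forall>i. 0 \<le> \<pi> $ i) \<and> (\<Sum>i\<in>UNIV. \<pi> $ i) = 1 \<and> \<pi> v* A = \<pi>"
  have inv: "matpow A t *v \<pi> = \<pi>" for t
  proof (induction t)
    case (Suc t)
    have "A *v \<pi> = \<pi>" using \<pi> vector_transpose_matrix[of \<pi> A] sym by simp
    with Suc show ?case by (simp add: matrix_vector_mul_assoc[symmetric])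
  qed simp
  have "(\<lambda>t. matpow A t $ i $ j) \<longlonglongrightarrow> 1 / real CARD('n)" for i j
    using summable_LIMSEQ_zero[OF summable_dev] by (rule LIM_zero_cancel)
  then have "(\<lambda>t. (matpow A t *v \<pi>) $ i) \<longlonglongrightarrow> (\<Sum>j\<in>UNIV. 1 / real CARD('n) * \<pi> $ j)" for i
    unfolding matrix_vector_mult_def vec_lambda_beta by (intro tendsto_sum tendsto_mult tendsto_const)
  then have "(\<lambda>t. \<pi> $ i) \<longlonglongrightarrow> 1 / real CARD('n)" for i
    using \<pi> by (simp add: inv sum_divide_distrib[symmetric])
  then show "\<pi> = vec (1 / real CARD('n))"
    by (simp add: vec_eq_iff LIMSEQ_const_iff)
qed

text \<open>The weight \<open>1/n\<close> cancels the factor \<open>n\<close> in the hitting times.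
  The value is the same for every starting state, so the description in \<open>kemeny\<close> is
  well defined.\<close>

lemma kemeny_eq: "kemeny A = ennreal (\<Sum>j\<in>UNIV. fundamental j j)"
proof -
  have eq: "(\<Sum>j\<in>UNIV. ennreal (stationary_distribution A $ j) * hitting_time A i j) =
      ennreal (\<Sum>j\<in>UNIV. fundamental j j)" for i
  proof -
    have "(\<Sum>j\<in>UNIV. ennreal (stationary_distribution A $ j) * hitting_time A i j) =
        (\<Sum>j\<in>UNIV. ennreal (fundamental j j - fundamental i j))"
      unfolding stationary_distribution_eq hitting_time_eq_fundamental
      using fundamental_diff_nonneg by (intro sum.cong) (auto simp: ennreal_mult'[symmetric])
    also have "\<dots> = ennreal (\<Sum>j\<in>UNIV. fundamental j j - fundamental i j)"
      using fundamental_diff_nonneg by (intro sum_ennreal) (simp add: zero_le_mult_iff)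
    finally show ?thesis by (simp add: sum_subtractf sum_fundamental)
  qed
  show ?thesis
    unfolding kemeny_def eq by (rule the_equality) auto
qed

end


subsection \<open>Noise and deviation from formation\<close>

text \<open>Coordinates of independent vectors are independent, so the expectation of each product
  of coordinates factors into zero means.\<close>

lemma (in prob_space) indep_var_inner_mean_zero:
  fixes X Y :: "'a \<Rightarrow> 'b::euclidean_space"
  assumes ind: "indep_var borel X borel Y"
    and X: "has_bochner_integral M X 0" and Y: "has_bochner_integral M Y 0"
  shows "has_bochner_integral M (\<lambda>\<omega>. X \<omega> \<bullet> Y \<omega>) 0"
proof -
  have "has_bochner_integral M (\<lambda>\<omega>. (X \<omega> \<bullet> b) * (Y \<omega> \<bullet> b)) 0" for b
  proof -
    have Xb: "has_bochner_integral M (\<lambda>\<omega>. X \<omega> \<bullet> b) 0" and Yb: "has_bochner_integral M (\<lambda>\<omega>. Y \<omega> \<bullet> b) 0"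
      using has_bochner_integral_inner_left[OF X, of b] has_bochner_integral_inner_left[OF Y, of b]
      by simp_all
    have "indep_var borel ((\<lambda>x. x \<bullet> b) \<circ> X) borel ((\<lambda>x. x \<bullet> b) \<circ> Y)"
      by (rule indep_var_compose[OF ind]) simp_all
    then have i: "indep_var borel (\<lambda>\<omega>. X \<omega> \<bullet> b) borel (\<lambda>\<omega>. Y \<omega> \<bullet> b)"
      by (simp add: o_def)
    show ?thesis
      using indep_var_integrable[OF i] indep_var_lebesgue_integral[OF i] Xb Yb
      by (simp add: has_bochner_integral_iff)
  qed
  then have "has_bochner_integral M (\<lambda>\<omega>. \<Sum>b\<in>Basis. (X \<omega> \<bullet> b) * (Y \<omega> \<bullet> b)) (\<Sum>b\<in>(Basis::'b set). 0)"
    by (intro has_bochner_integral_sum)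
  then show ?thesis by (simp add: euclidean_inner[symmetric])
qed

text \<open>Pythagoras in expectation: cross terms with \<open>c\<close> vanish because the means
  are zero, mixed terms by orthogonality.\<close>

lemma (in prob_space) expected_sq_norm_orthogonal_sum:
  fixes X :: "'k \<Rightarrow> 'a \<Rightarrow> 'b::euclidean_space"
  assumes fin: "finite I"
    and mean: "\<And>k. k \<in> I \<Longrightarrow> has_bochner_integral M (X k) 0"
    and var: "\<And>k. k \<in> I \<Longrightarrow> has_bochner_integral M (\<lambda>\<omega>. X k \<omega> \<bullet> X k \<omega>) v"
    and orth: "\<And>k l. k \<in> I \<Longrightarrow> l \<in> I \<Longrightarrow> k \<noteq> l \<Longrightarrow> has_bochner_integral M (\<lambda>\<omega>. X k \<omega> \<bullet> X l \<omega>) 0"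
  shows "has_bochner_integral M (\<lambda>\<omega>. (norm (c + (\<Sum>k\<in>I. w k *\<^sub>R X k \<omega>)))\<^sup>2)
    ((norm c)\<^sup>2 + v * (\<Sum>k\<in>I. (w k)\<^sup>2))"
proof -
  have const: "has_bochner_integral M (\<lambda>\<omega>. c \<bullet> c) (c \<bullet> c)"
    by (simp add: has_bochner_integral_iff prob_space)
  have lin: "has_bochner_integral M (\<lambda>\<omega>. \<Sum>k\<in>I. 2 * w k * (c \<bullet> X k \<omega>)) (\<Sum>k\<in>I. 2 * w k * (c \<bullet> 0))"
    by (intro has_bochner_integral_sum has_bochner_integral_mult_right has_bochner_integral_inner_right mean)
  have "has_bochner_integral M (\<lambda>\<omega>. \<Sum>k\<in>I. \<Sum>l\<in>I. w k * w l * (X k \<omega> \<bullet> X l \<omega>))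
      (\<Sum>k\<in>I. \<Sum>l\<in>I. w k * w l * (if k = l then v else 0))"
    using var orth by (intro has_bochner_integral_sum has_bochner_integral_mult_right) auto
  from has_bochner_integral_add[OF has_bochner_integral_add[OF const lin] this]
  have "has_bochner_integral M (\<lambda>\<omega>. c \<bullet> c + (\<Sum>k\<in>I. 2 * w k * (c \<bullet> X k \<omega>)) +
      (\<Sum>k\<in>I. \<Sum>l\<in>I. w k * w l * (X k \<omega> \<bullet> X l \<omega>)))
      (c \<bullet> c + (\<Sum>k\<in>I. 2 * w k * (c \<bullet> 0)) + (\<Sum>k\<in>I. \<Sum>l\<in>I. w k * w l * (if k = l then v else 0)))" .
  moreover have "c \<bullet> c + (\<Sum>k\<in>I. 2 * w k * (c \<bullet> X k \<omega>)) + (\<Sum>k\<in>I. \<Sum>l\<in>I. w k * w l * (X k \<omega> \<bullet> X l \<omega>)) =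
      (norm (c + (\<Sum>k\<in>I. w k *\<^sub>R X k \<omega>)))\<^sup>2" for \<omega>
  proof -
    have "(\<Sum>k\<in>I. w k *\<^sub>R X k \<omega>) \<bullet> (\<Sum>k\<in>I. w k *\<^sub>R X k \<omega>) = (\<Sum>k\<in>I. \<Sum>l\<in>I. w k * w l * (X k \<omega> \<bullet> X l \<omega>))"
      by (simp add: inner_sum_left inner_sum_right sum_distrib_left mult.assoc mult.left_commute inner_commute)
    moreover have "2 * (c \<bullet> (\<Sum>k\<in>I. w k *\<^sub>R X k \<omega>)) = (\<Sum>k\<in>I. 2 * w k * (c \<bullet> X k \<omega>))"
      by (simp add: inner_sum_right sum_distrib_left mult.assoc)
    moreover have "(norm (c + y))\<^sup>2 = c \<bullet> c + 2 * (c \<bullet> y) + y \<bullet> y" for y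
      by (simp add: power2_norm_eq_inner inner_add_left inner_add_right inner_commute)
    ultimately show ?thesis by simp
  qed
  moreover have "c \<bullet> c + (\<Sum>k\<in>I. 2 * w k * (c \<bullet> 0)) + (\<Sum>k\<in>I. \<Sum>l\<in>I. w k * w l * (if k = l then v else 0)) =
      (norm c)\<^sup>2 + v * (\<Sum>k\<in>I. (w k)\<^sup>2)"
    using fin by (simp add: dot_square_norm sum_distrib_left power2_eq_square mult_ac
        if_distrib[of "(*) _"] cong: if_cong)
  ultimately show ?thesis by simp
qed

text \<open>The trace is a bounded linear map, so it commutes with the integral; it sends
  \<open>outer x x\<close> to \<open>x \<bullet> x\<close>.\<close>

lemma has_bochner_integral_outer_imp_inner:
  fixes X :: "'w \<Rightarrow> real ^ 'd"
  assumes "has_bochner_integral M (\<lambda>\<omega>. outer (X \<omega>) (X \<omega>)) (c *\<^sub>R mat 1)"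
  shows "has_bochner_integral M (\<lambda>\<omega>. X \<omega> \<bullet> X \<omega>) (real CARD('d) * c)"
proof -
  have "bounded_linear (\<lambda>B::real^'d^'d. \<Sum>a\<in>UNIV. B $ a $ a)"
    by (intro bounded_linear_sum bounded_linear_compose[OF bounded_linear_vec_nth bounded_linear_vec_nth])
  from has_bochner_integral_bounded_linear[OF this assms] show ?thesis
    by (simp add: outer_def inner_vec_def mat_def)
qed

text \<open>The columns of \<open>B\<close> also sum to one, so averaging preserves the centroid,
  here written out as a sum.\<close>

lemma centroid_stochastic_combination:
  fixes x :: "'n::finite \<Rightarrow> real ^ 'd"
  assumes "stochastic B" "transpose B = B"
  shows "centroid (\<lambda>i. \<Sum>j\<in>UNIV. B $ i $ j *\<^sub>R x j) = (1 / real CARD('n)) *\<^sub>R (\<Sum>j\<in>UNIV. x j)"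
proof -
  have "(\<Sum>i\<in>UNIV. \<Sum>j\<in>UNIV. B $ i $ j *\<^sub>R x j) = (\<Sum>j\<in>UNIV. (\<Sum>i\<in>UNIV. B $ j $ i) *\<^sub>R x j)"
    by (subst sum.swap) (simp add: scaleR_sum_left symmetric_nth[OF assms(2)])
  then show ?thesis using assms(1) by (simp add: centroid_def stochastic_def)
qed

lemma centroid_add: "centroid (\<lambda>i. x i + y i) = centroid x + centroid y"
  by (simp add: centroid_def sum.distrib scaleR_add_right)

lemma centroid_diff: "centroid (\<lambda>i. x i - y i) = centroid x - centroid y"
  by (simp add: centroid_def sum_subtractf scaleR_diff_right)

lemma centroid_sum: "centroid (\<lambda>i. \<Sum>s\<in>I. x s i) = (\<Sum>s\<in>I. centroid (x s))"
  unfolding centroid_def by (subst sum.swap) (simp add: scaleR_sum_right)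

text \<open>Connectedness means reachability in the symmetric closure, and equality of values
  propagates along arcs in either direction.\<close>

lemma connected_arc_invariant:
  assumes verts: "pverts G = UNIV" and conn: "Digraph_Component.connected (with_proj G)"
    and inv: "\<And>i j. (i, j) \<in> parcs G \<Longrightarrow> x i = x j"
  shows "x i = x j"
proof -
  have "i \<rightarrow>\<^sup>*\<^bsub>with_proj (mk_symmetric (with_proj G))\<^esub> j"
    using conn verts by (simp add: Digraph_Component.connected_def strongly_connected_def)
  then have "(i, j) \<in> (parcs (mk_symmetric (with_proj G)))\<^sup>*"
    using reachable_rtranclI by fastforce
  then show ?thesis
    by (induction rule: rtrancl_induct) (auto simp: parcs_mk_symmetric dest: inv)
qed

section \<open>Points in formation and the linear recursion\<close>

lemma in_formationD:
  assumes "in_formation G r q" "(i, j) \<in> parcs G"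
  shows "r i j = q j - q i"
  using assms unfolding in_formation_def by fastforce

text \<open>On a connected graph two collections in formation differ by a translation, which the
  centroid determines.\<close>

lemma formation_of_eq:
  fixes G :: "'n::finite pair_pre_digraph" and p q :: "'n \<Rightarrow> real ^ 'd"
  assumes verts: "pverts G = UNIV" and conn: "Digraph_Component.connected (with_proj G)"
    and q: "in_formation G r q"
  shows "formation_of G r p = (\<lambda>i. q i + centroid (\<lambda>k. p k - q k))"
  unfolding formation_of_def
proof (rule the_equality)
  have const: "centroid (\<lambda>_::'n. c :: real ^ 'd) = c" for c
    by (simp add: centroid_def sum_constant_scaleR del: sum_constant)
  show "in_formation G r (\<lambda>i. q i + centroid (\<lambda>k. p k - q k)) \<and>
      centroid (\<lambda>i. q i + centroid (\<lambda>k. p k - q k)) = centroid p"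
    using q by (auto simp: in_formation_def centroid_add centroid_diff const)
  fix q' assume q': "in_formation G r q' \<and> centroid q' = centroid p"
  have "q' i - q i = q' j - q j" for i j
  proof (rule connected_arc_invariant[OF verts conn])
    fix k l assume kl: "(k, l) \<in> parcs G"
    have "q l - q k = q' l - q' k"
      using in_formationD[OF q kl] in_formationD[of G r q', OF _ kl] q' by simp
    then show "q' k - q k = q' l - q l" by (simp add: algebra_simps)
  qed
  then have "(\<lambda>k. q' k - q k) = (\<lambda>_. q' i - q i)" for i by blast
  then have "centroid q' - centroid q = q' i - q i" for i
    by (metis centroid_diff const)
  then show "q' = (\<lambda>i. q i + centroid (\<lambda>k. p k - q k))"
    using q' by (auto simp: centroid_diff fun_eq_iff algebra_simps)
qed

text \<open>Stated for any real vector space: it rewrites the position update and, with the constant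
  1, gives the row sums of \<open>P_form\<close>.\<close>

lemma sum_P_form_scaleR:
  fixes x :: "'n::finite \<Rightarrow> 'b::real_vector"
  assumes "(i, i) \<notin> parcs G"
  shows "(\<Sum>j\<in>UNIV. P_form G f $ i $ j *\<^sub>R x j) = x i + (\<Sum>j\<in>neighbours G i. f i j *\<^sub>R (x j - x i))"
proof -
  have "(\<Sum>j\<in>UNIV. P_form G f $ i $ j *\<^sub>R x j) =
      P_form G f $ i $ i *\<^sub>R x i + (\<Sum>j\<in>UNIV - {i}. P_form G f $ i $ j *\<^sub>R x j)"
    by (rule sum.remove) auto
  also have "(\<Sum>j\<in>UNIV - {i}. P_form G f $ i $ j *\<^sub>R x j) = (\<Sum>j\<in>neighbours G i. f i j *\<^sub>R x j)"
    using assms by (intro sum.mono_neutral_cong_right) (auto simp: P_form_def neighbours_def)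
  finally show ?thesis
    by (simp add: P_form_def scaleR_diff_left scaleR_diff_right sum_subtractf scaleR_sum_left)
qed

lemma stochastic_P_form:
  assumes noloop: "\<And>i. (i, i) \<notin> parcs G"
    and pos: "\<And>i j. (i, j) \<in> parcs G \<Longrightarrow> 0 < f i j"
    and sum: "\<And>i. (\<Sum>j\<in>neighbours G i. f i j) < 1"
  shows "stochastic (P_form G f)"
proof -
  have "(\<Sum>j\<in>UNIV. P_form G f $ i $ j) = 1" for i
    using sum_P_form_scaleR[OF noloop, where x = "\<lambda>_. 1::real"] by simp
  moreover have "0 \<le> P_form G f $ i $ j" for i j
    using pos[of i j] sum[of i] by (auto simp: P_form_def)
  ultimately show ?thesis by (simp add: stochastic_def)
qed

text \<open>Subtracting a formation cancels every \<open>r i j\<close> and leaves a linear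
  recursion. Noise added at time \<open>s\<close> is already part of the position at time
  \<open>s + 1\<close>, hence the exponent \<open>t - Suc s\<close>.\<close>

lemma position_minus_formation:
  fixes f :: "'n::finite \<Rightarrow> 'n \<Rightarrow> real" and p0 q :: "'n \<Rightarrow> real ^ 'd"
  assumes noloop: "\<And>i. (i, i) \<notin> parcs G" and q: "in_formation G r q"
  defines "P \<equiv> P_form G f"
  shows "position G f r p0 noise t \<omega> i - q i =
    (\<Sum>j\<in>UNIV. matpow P t $ i $ j *\<^sub>R (p0 j - q j)) +
    (\<Sum>s<t. \<Sum>j\<in>UNIV. matpow P (t - Suc s) $ i $ j *\<^sub>R noise j s \<omega>)"
proof (induction t arbitrary: i)
  case 0
  then show ?case by (simp add: mat_def if_distrib[of "\<lambda>c. c *\<^sub>R _"] cong: if_cong)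
next
  case (Suc t)
  define z where "z i = position G f r p0 noise t \<omega> i - q i" for i
  have mult: "(\<Sum>k\<in>UNIV. P $ i $ k *\<^sub>R (\<Sum>j\<in>UNIV. matpow P s $ k $ j *\<^sub>R y j)) =
      (\<Sum>j\<in>UNIV. matpow P (Suc s) $ i $ j *\<^sub>R y j)" for s and y :: "'n \<Rightarrow> real ^ 'd"
    unfolding matpow_Suc_nth scaleR_sum_left scaleR_sum_right scaleR_scaleR by (rule sum.swap)
  have "(\<Sum>j\<in>neighbours G i. f i j *\<^sub>R (position G f r p0 noise t \<omega> j - position G f r p0 noise t \<omega> i - r i j)) =
      (\<Sum>j\<in>neighbours G i. f i j *\<^sub>R (z j - z i))"
  proof (rule sum.cong[OF refl])
    fix j assume "j \<in> neighbours G i"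
    then have r: "r i j = q j - q i" by (intro in_formationD[OF q]) (simp add: neighbours_def)
    show "f i j *\<^sub>R (position G f r p0 noise t \<omega> j - position G f r p0 noise t \<omega> i - r i j) = f i j *\<^sub>R (z j - z i)"
      unfolding r z_def by (simp add: algebra_simps)
  qed
  then have "position G f r p0 noise (Suc t) \<omega> i - q i =
      z i + (\<Sum>j\<in>neighbours G i. f i j *\<^sub>R (z j - z i)) + noise i t \<omega>"
    by (simp add: Let_def z_def)
  also have "\<dots> = (\<Sum>k\<in>UNIV. P $ i $ k *\<^sub>R z k) + noise i t \<omega>"
    unfolding P_def by (simp only: sum_P_form_scaleR[OF noloop])
  also have "(\<Sum>k\<in>UNIV. P $ i $ k *\<^sub>R z k) =
      (\<Sum>k\<in>UNIV. P $ i $ k *\<^sub>R (\<Sum>j\<in>UNIV. matpow P t $ k $ j *\<^sub>R (p0 j - q j))) +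
      (\<Sum>s<t. \<Sum>k\<in>UNIV. P $ i $ k *\<^sub>R (\<Sum>j\<in>UNIV. matpow P (t - Suc s) $ k $ j *\<^sub>R noise j s \<omega>))"
    unfolding z_def Suc.IH scaleR_add_right sum.distrib
    by (subst (2) sum.swap) (simp only: scaleR_sum_right)
  also have "\<dots> = (\<Sum>j\<in>UNIV. matpow P (Suc t) $ i $ j *\<^sub>R (p0 j - q j)) +
      (\<Sum>s<t. \<Sum>j\<in>UNIV. matpow P (Suc t - Suc s) $ i $ j *\<^sub>R noise j s \<omega>)"
    unfolding mult by (simp add: Suc_diff_Suc cong: sum.cong_simp del: matpow.simps)
  \<comment> \<open>The newest noise becomes the term \<open>s = t\<close>, multiplied by the zeroth
    power.\<close>
  also have "noise i t \<omega> = (\<Sum>j\<in>UNIV. matpow P (Suc t - Suc t) $ i $ j *\<^sub>R noise j t \<omega>)"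
    by (simp add: mat_def if_distrib[of "\<lambda>c. c *\<^sub>R _"] cong: if_cong)
  finally show ?case by (simp only: sum.lessThan_Suc add.assoc)
qed

text \<open>Removing the centroid subtracts \<open>1/n\<close> from every coefficient. Time and
  agent are paired in one index so that the noise forms a single orthogonal family.\<close>

lemma position_minus_formation_of:
  fixes f :: "'n::finite \<Rightarrow> 'n \<Rightarrow> real" and p0 q :: "'n \<Rightarrow> real ^ 'd"
    and noise :: "'n \<Rightarrow> nat \<Rightarrow> 'w \<Rightarrow> real ^ 'd" and \<omega> :: 'w
  assumes verts: "pverts G = UNIV" and conn: "Digraph_Component.connected (with_proj G)"
    and noloop: "\<And>i. (i, i) \<notin> parcs G" and q: "in_formation G r q"
    and st: "stochastic (P_form G f)" and sym: "transpose (P_form G f) = P_form G f"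
  defines "D \<equiv> \<lambda>t i j. matpow (P_form G f) t $ i $ j - 1 / real CARD('n)"
    and "p \<equiv> \<lambda>t. position G f r p0 noise t \<omega>"
  shows "p t i - formation_of G r (p t) i =
    (\<Sum>j\<in>UNIV. D t i j *\<^sub>R (p0 j - q j)) +
    (\<Sum>(s, j)\<in>{..<t} \<times> UNIV. D (t - Suc s) i j *\<^sub>R noise j s \<omega>)"
proof -
  let ?P = "P_form G f"
  have z: "p t k - q k = (\<Sum>j\<in>UNIV. matpow ?P t $ k $ j *\<^sub>R (p0 j - q j)) +
    (\<Sum>s<t. \<Sum>j\<in>UNIV. matpow ?P (t - Suc s) $ k $ j *\<^sub>R noise j s \<omega>)" for k
    unfolding p_def by (rule position_minus_formation[OF noloop q])
  have centr: "centroid (\<lambda>i. \<Sum>j\<in>UNIV. matpow ?P s $ i $ j *\<^sub>R x j) = (\<Sum>j\<in>UNIV. (1 / real CARD('n)) *\<^sub>R x j)"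
    for s and x :: "'n \<Rightarrow> real ^ 'd"
    by (simp only: centroid_stochastic_combination stochastic_matpow[OF st] transpose_matpow[OF sym] scaleR_sum_right)
  have "p t i - formation_of G r (p t) i = (p t i - q i) - centroid (\<lambda>k. p t k - q k)"
    unfolding formation_of_eq[OF verts conn q] by simp
  also have "\<dots> = (\<Sum>j\<in>UNIV. D t i j *\<^sub>R (p0 j - q j)) +
      (\<Sum>s<t. \<Sum>j\<in>UNIV. D (t - Suc s) i j *\<^sub>R noise j s \<omega>)"
    unfolding z centroid_add centroid_sum[where I = "{..<t}"] centr D_def scaleR_diff_left sum_subtractf by simp
  finally show ?thesis by (simp add: sum.cartesian_product)
qed


subsection \<open>The performance measure\<close>

text \<open>Powers of \<open>P ** P\<close> are even powers of \<open>P\<close>, so the deviations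
  are dominated by a geometric series of ratio \<open>\<rho>\<^sup>2\<close>.\<close>

lemma symmetric_mixing_chain_square:
  fixes P :: "real ^ 'n ^ 'n::finite"
  assumes st: "stochastic P" and sym: "transpose P = P"
    and \<rho>: "0 \<le> \<rho>" "\<rho> < 1"
    and geo: "\<And>t i j. \<bar>matpow P t $ i $ j - 1 / real CARD('n)\<bar> \<le> 2 * \<rho> ^ t"
  shows "symmetric_mixing_chain (P ** P)"
proof
  show "stochastic (P ** P)" by (rule stochastic_mult[OF st st])
  show "transpose (P ** P) = P ** P" by (simp add: matrix_transpose_mul sym)
  fix i j
  have "\<rho>\<^sup>2 < 1" using \<rho> by (simp add: abs_square_less_1)
  then have "summable (\<lambda>t. 2 * (\<rho>\<^sup>2) ^ t)"
    by (intro summable_mult summable_geometric) simp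
  then show "summable (\<lambda>t. matpow (P ** P) t $ i $ j - 1 / real CARD('n))"
  proof (rule summable_comparison_test'[where N = 0])
    show "norm (matpow (P ** P) t $ i $ j - 1 / real CARD('n)) \<le> 2 * (\<rho>\<^sup>2) ^ t" for t
      using geo[of "2 * t" i j] by (simp add: matpow_square power_mult)
  qed
qed

text \<open>By symmetry the squares in row \<open>i\<close> of \<open>matpow P t\<close> sum to a
  diagonal entry of the squared power; the corrections \<open>1/n\<close> and \<open>- 2/n\<close>
  combine to \<open>- 1/n\<close>.\<close>

lemma sum_sq_matpow_deviation:
  fixes P :: "real ^ 'n ^ 'n::finite"
  assumes st: "stochastic P" and sym: "transpose P = P"
  shows "(\<Sum>j\<in>UNIV. (matpow P t $ i $ j - 1 / real CARD('n))\<^sup>2) =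
    matpow (P ** P) t $ i $ i - 1 / real CARD('n)"
proof -
  have row: "(\<Sum>j\<in>UNIV. matpow P t $ i $ j) = 1"
    using stochastic_matpow[OF st] by (simp add: stochastic_def)
  have "matpow (P ** P) t $ i $ i = (matpow P t ** matpow P t) $ i $ i"
    by (simp add: matpow_square matpow_add[symmetric] mult_2)
  also have "\<dots> = (\<Sum>j\<in>UNIV. (matpow P t $ i $ j)\<^sup>2)"
    unfolding matrix_matrix_mult_def power2_eq_square
    using symmetric_nth[OF transpose_matpow[OF sym, of t]] by simp
  finally have sq: "(\<Sum>j\<in>UNIV. (matpow P t $ i $ j)\<^sup>2) = matpow (P ** P) t $ i $ i" ..
  have "(\<Sum>j\<in>UNIV. (matpow P t $ i $ j - 1 / real CARD('n))\<^sup>2) =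
      (\<Sum>j\<in>UNIV. (matpow P t $ i $ j)\<^sup>2) + (\<Sum>j\<in>(UNIV::'n set). (1 / real CARD('n))\<^sup>2)
      - 2 * (1 / real CARD('n)) * (\<Sum>j\<in>UNIV. matpow P t $ i $ j)"
    by (simp only: power2_diff sum.distrib sum_subtractf sum_distrib_left mult_ac)
  then show ?thesis unfolding sq row by (simp add: power2_eq_square)
qed

theorem theorem8:
  fixes G :: "'n::finite pair_pre_digraph"
    and f :: "'n \<Rightarrow> 'n \<Rightarrow> real"
    and r :: "'n \<Rightarrow> 'n \<Rightarrow> real ^ 'd"
    and p0 :: "'n \<Rightarrow> real ^ 'd"
    and M :: "'w measure"
    and noise :: "'n \<Rightarrow> nat \<Rightarrow> 'w \<Rightarrow> real ^ 'd"
    and lam :: real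
  assumes vertices: "pverts G = UNIV"
    and bidirectional: "pair_bidirected_digraph G"
    and conn: "Digraph_Component.connected (with_proj G)"
    and formation_exists: "\<exists>q. in_formation G r q"
    and f_pos: "\<And>i j. (i, j) \<in> parcs G \<Longrightarrow> 0 < f i j"
    and f_sum: "\<And>i. (\<Sum>j\<in>neighbours G i. f i j) < 1"
    and f_sym: "\<And>i j. (i, j) \<in> parcs G \<Longrightarrow> f i j = f j i"
    and prob: "prob_space M"
    and noise_mean: "\<And>i t. has_bochner_integral M (noise i t) 0"
    and noise_cov: "\<And>i t. has_bochner_integral M
          (\<lambda>\<omega>. outer (noise i t \<omega>) (noise i t \<omega>)) (lam\<^sup>2 *\<^sub>R mat 1)"
    and noise_indep: "\<And>i j t1 t2. t1 \<noteq> t2 \<or> i \<noteq> j \<Longrightarrow>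
          prob_space.indep_var M borel (noise i t1) borel (noise j t2)"
  shows "Form G f r p0 M noise =
    ennreal (real CARD('d) * lam\<^sup>2) * kemeny (P_form G f ** P_form G f) / of_nat CARD('n)"
proof -
  interpret prob_space M by (rule prob)
  interpret G: pair_bidirected_digraph G by (rule bidirectional)
  define P where "P = P_form G f"
  define D where "D t i j = matpow P t $ i $ j - 1 / real CARD('n)" for t i j
  obtain q where q: "in_formation G r q" using formation_exists by blast
  have noloop: "(i, i) \<notin> parcs G" for i
    using G.pair_no_loops by force
  have arc_sym: "(i, j) \<in> parcs G \<Longrightarrow> (j, i) \<in> parcs G" for i j
    using G.sym_arcs by (auto simp: symmetric_def dest: symD)
  have st: "stochastic P"
    unfolding P_def using noloop f_pos f_sum by (rule stochastic_P_form)
  have sym: "transpose P = P"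
    using f_sym arc_sym by (auto simp: P_def P_form_def transpose_def vec_eq_iff)
  have diag: "0 < P $ i $ i" for i
    using f_sum[of i] by (simp add: P_def P_form_def)
  \<comment> \<open>Every arc is a positive off-diagonal entry of \<open>P\<close>, so graph
    connectedness yields the irreducibility condition.\<close>
  have P_conn: "x i = x j" if "\<And>i j. 0 < P $ i $ j \<Longrightarrow> x i = x j" for x :: "'n \<Rightarrow> real" and i j
  proof (rule connected_arc_invariant[OF vertices conn])
    fix k l assume kl: "(k, l) \<in> parcs G"
    then have "k \<noteq> l" using noloop by blast
    then show "x k = x l" using kl f_pos by (intro that) (simp add: P_def P_form_def)
  qed
  obtain \<rho> where \<rho>: "0 \<le> \<rho>" "\<rho> < 1"
    and geo: "\<And>t i j. \<bar>matpow P t $ i $ j - 1 / real CARD('n)\<bar> \<le> 2 * \<rho> ^ t"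
    using symmetric_stochastic_geometric[OF st sym diag P_conn] by metis
  interpret K: symmetric_mixing_chain "P ** P"
    by (rule symmetric_mixing_chain_square[OF st sym \<rho> geo])
  \<comment> \<open>\<open>c\<close> is the deterministic contribution of the initial positions,
    \<open>v\<close> the expected squared norm of one noise vector, and \<open>S\<close> the partial
    sums of the trace of \<open>fundamental\<close> for \<open>P ** P\<close>.\<close>
  define c where "c t i = (\<Sum>j\<in>UNIV. D t i j *\<^sub>R (p0 j - q j))" for t i
  define v where "v = real CARD('d) * lam\<^sup>2"
  define S where "S t = (\<Sum>s<t. \<Sum>i\<in>UNIV. matpow (P ** P) s $ i $ i - 1 / real CARD('n))" for t
  have E: "(\<integral>\<^sup>+\<omega>. (let p = position G f r p0 noise t \<omega>
        in ennreal ((norm (p i - formation_of G r p i))\<^sup>2)) \<partial>M) =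
      ennreal ((norm (c t i))\<^sup>2 + v * (\<Sum>s<t. \<Sum>j\<in>UNIV. (D s i j)\<^sup>2))" for t i
  proof -
    have "has_bochner_integral M
        (\<lambda>\<omega>. (norm (c t i + (\<Sum>k\<in>{..<t} \<times> UNIV. D (t - Suc (fst k)) i (snd k) *\<^sub>R noise (snd k) (fst k) \<omega>)))\<^sup>2)
        ((norm (c t i))\<^sup>2 + v * (\<Sum>k\<in>{..<t} \<times> UNIV. (D (t - Suc (fst k)) i (snd k))\<^sup>2))"
    proof (rule expected_sq_norm_orthogonal_sum)
      fix k l :: "nat \<times> 'n" assume "k \<noteq> l"
      then have "fst k \<noteq> fst l \<or> snd k \<noteq> snd l" by (simp add: prod_eq_iff)
      then show "has_bochner_integral M (\<lambda>\<omega>. noise (snd k) (fst k) \<omega> \<bullet> noise (snd l) (fst l) \<omega>) 0"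
        by (intro indep_var_inner_mean_zero noise_indep noise_mean)
    qed (auto simp: v_def intro!: noise_mean has_bochner_integral_outer_imp_inner noise_cov)
    also have "(\<lambda>\<omega>. (norm (c t i + (\<Sum>k\<in>{..<t} \<times> UNIV. D (t - Suc (fst k)) i (snd k) *\<^sub>R noise (snd k) (fst k) \<omega>)))\<^sup>2) =
        (\<lambda>\<omega>. (norm (position G f r p0 noise t \<omega> i - formation_of G r (position G f r p0 noise t \<omega>) i))\<^sup>2)"
      unfolding position_minus_formation_of[OF vertices conn noloop q st[unfolded P_def] sym[unfolded P_def]]
      by (simp add: P_def c_def D_def case_prod_unfold)
    also have "(\<Sum>k\<in>{..<t} \<times> UNIV. (D (t - Suc (fst k)) i (snd k))\<^sup>2) = (\<Sum>s<t. \<Sum>j\<in>UNIV. (D (t - Suc s) i j)\<^sup>2)"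
      by (simp add: sum.cartesian_product case_prod_unfold)
    \<comment> \<open>Reversing time, \<open>s\<close> now counts the steps since the noise was
      propagated first.\<close>
    also have "\<dots> = (\<Sum>s<t. \<Sum>j\<in>UNIV. (D s i j)\<^sup>2)"
      by (rule sum.nat_diff_reindex)
    finally show ?thesis
      by (simp add: Let_def has_bochner_integral_iff nn_integral_eq_integral)
  qed
  have "(\<Sum>i\<in>UNIV. \<integral>\<^sup>+\<omega>. (let p = position G f r p0 noise t \<omega>
        in ennreal ((norm (p i - formation_of G r p i))\<^sup>2)) \<partial>M) / of_nat CARD('n) =
      ennreal (((\<Sum>i\<in>UNIV. (norm (c t i))\<^sup>2) + v * S t) / real CARD('n))" for t
  proof -
    have "0 \<le> (norm (c t i))\<^sup>2 + v * (\<Sum>s<t. \<Sum>j\<in>UNIV. (D s i j)\<^sup>2)" for i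
      by (auto simp: v_def intro!: add_nonneg_nonneg mult_nonneg_nonneg sum_nonneg)
    then have "(\<Sum>i\<in>UNIV. ennreal ((norm (c t i))\<^sup>2 + v * (\<Sum>s<t. \<Sum>j\<in>UNIV. (D s i j)\<^sup>2))) / of_nat CARD('n) =
        ennreal ((\<Sum>i\<in>UNIV. (norm (c t i))\<^sup>2 + v * (\<Sum>s<t. \<Sum>j\<in>UNIV. (D s i j)\<^sup>2)) / real CARD('n))"
      by (simp add: sum_ennreal sum_nonneg divide_ennreal ennreal_of_nat_eq_real_of_nat)
    moreover have "(\<Sum>i\<in>UNIV. (norm (c t i))\<^sup>2 + v * (\<Sum>s<t. \<Sum>j\<in>UNIV. (D s i j)\<^sup>2)) =
        (\<Sum>i\<in>UNIV. (norm (c t i))\<^sup>2) + v * S t"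
      unfolding D_def sum_sq_matpow_deviation[OF st sym] S_def
      by (simp only: sum.distrib sum_distrib_left[symmetric] sum.swap[of _ "{..<t}" UNIV])
    ultimately show ?thesis unfolding E by simp
  qed
  moreover have "(\<lambda>t. ((\<Sum>i\<in>UNIV. (norm (c t i))\<^sup>2) + v * S t) / real CARD('n))
      \<longlonglongrightarrow> ((\<Sum>i\<in>(UNIV::'n set). 0) + v * (\<Sum>i\<in>UNIV. K.fundamental i i)) / real CARD('n)"
  proof (intro tendsto_divide tendsto_add tendsto_mult tendsto_const tendsto_sum)
    have "(\<lambda>t. 2 * \<rho> ^ t) \<longlonglongrightarrow> 0"
      using \<rho> by (intro tendsto_mult_right_zero LIMSEQ_power_zero) simp
    then have "(\<lambda>t. D t i j) \<longlonglongrightarrow> 0" for i j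
      by (rule Lim_null_comparison[rotated]) (simp add: D_def geo)
    then have "(\<lambda>t. c t i) \<longlonglongrightarrow> (\<Sum>j\<in>UNIV. 0 *\<^sub>R (p0 j - q j))" for i
      unfolding c_def by (intro tendsto_sum tendsto_scaleR tendsto_const)
    then have "(\<lambda>t. c t i) \<longlonglongrightarrow> 0" for i by simp
    from tendsto_power[OF tendsto_norm[OF this], where n = 2]
    show "(\<lambda>t. (norm (c t i))\<^sup>2) \<longlonglongrightarrow> 0" for i by simp
    have "(\<lambda>t. \<Sum>i\<in>UNIV. \<Sum>s<t. matpow (P ** P) s $ i $ i - 1 / real CARD('n)) \<longlonglongrightarrow> (\<Sum>i\<in>UNIV. K.fundamental i i)"
      unfolding K.fundamental_def by (intro tendsto_sum summable_LIMSEQ K.summable_dev)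
    then show "S \<longlonglongrightarrow> (\<Sum>i\<in>UNIV. K.fundamental i i)"
      unfolding S_def by (subst sum.swap)
  qed simp
  \<comment> \<open>The averaged errors converge as reals, so the limit superior is their
    limit.\<close>
  ultimately have "Form G f r p0 M noise = ennreal (v * (\<Sum>i\<in>UNIV. K.fundamental i i) / real CARD('n))"
    unfolding Form_def by (simp, intro lim_imp_Limsup tendsto_ennrealI) simp_all
  also have "\<dots> = ennreal (v / real CARD('n)) * ennreal (\<Sum>i\<in>UNIV. K.fundamental i i)"
    by (subst ennreal_mult'[symmetric]) (simp_all add: v_def)
  also have "\<dots> = ennreal v * kemeny (P ** P) / of_nat CARD('n)"
    by (simp add: K.kemeny_eq v_def divide_ennreal[symmetric] ennreal_of_nat_eq_real_of_nat
        ennreal_times_divide mult.commute)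
  finally show ?thesis by (simp add: v_def P_def)
qed

end
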